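(* For every constant $k$, the Superset-Simultaneous-Dipaths problem with $k$ color classes can be solved in polynomial time on instances in which the digraph is acyclic.
   Context: Superset-Simultaneous-Dipaths: the input is a positive integer $k$, a digraph $D=(V,A)$ with $A=A_1\cup\cdots\cup A_k$ (the color classes $A_i$ are not necessarily disjoint), two distinct vertices $s,t\in V$, and a conservative cost function $c\colon A\to\mathbb{R}$, where conservative means that there is no directed cycle of negative total cost. The task is to find $A'\subseteq A$ of minimum cost $\sum_{a\in A'}c(a)$ such that $A'\cap A_i$ contains (the arc set of) an $s$-$t$ dipath for all $i\in\{1,\ldots,k\}$, or to determine that no such $A'$ exists. A dipath is a directed path with no repeated vertices, identified with its arc set. Digraphs are finite and may have parallel arcs. *)

theory Defs
  imports
    Complex_Main
    "HOL-Computational_Algebra.Polynomial"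
    "Graph_Theory.Graph_Theory"
begin

section \<open>The problem Superset-Simultaneous-Dipaths\<close>

text \<open>
  Digraphs, walks and cycles are those of the AFP entry Graph_Theory: arcs are objects of their
  own (so parallel arcs are allowed), a walk is a list of arcs, \<^emph>\<open>apath\<close> is a walk without
  repeated vertices, and a loop counts as a cycle.
\<close>

record ('v, 'e) ssd_instance =
  graph :: "('v, 'e) pre_digraph"
  colour_class :: "nat \<Rightarrow> 'e set"
  source :: 'v
  target :: 'v
  cost :: "'e \<Rightarrow> real"

definition conservative :: "('v, 'e) pre_digraph \<Rightarrow> ('e \<Rightarrow> real) \<Rightarrow> bool" where
  "conservative G c \<longleftrightarrow> (\<forall>p. pre_digraph.cycle G p \<longrightarrow> 0 \<le> sum_list (map c p))"

definition acyclic_digraph :: "('v, 'e) pre_digraph \<Rightarrow> bool" where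
  "acyclic_digraph G \<longleftrightarrow> (\<nexists>p. pre_digraph.cycle G p)"

definition valid_instance :: "nat \<Rightarrow> ('v, 'e) ssd_instance \<Rightarrow> bool" where
  "valid_instance k I \<longleftrightarrow>
     fin_digraph (graph I) \<and>
     (\<Union>i\<in>{1..k}. colour_class I i) = arcs (graph I) \<and>
     source I \<in> verts (graph I) \<and> target I \<in> verts (graph I) \<and> source I \<noteq> target I \<and>
     conservative (graph I) (cost I)"

definition feasible :: "nat \<Rightarrow> ('v, 'e) ssd_instance \<Rightarrow> 'e set \<Rightarrow> bool" where
  "feasible k I A' \<longleftrightarrow>
     A' \<subseteq> arcs (graph I) \<and>
     (\<forall>i\<in>{1..k}. \<exists>p. pre_digraph.apath (graph I) (source I) p (target I) \<and>
                     set p \<subseteq> A' \<inter> colour_class I i)"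

definition optimal :: "nat \<Rightarrow> ('v, 'e) ssd_instance \<Rightarrow> 'e set \<Rightarrow> bool" where
  "optimal k I A' \<longleftrightarrow>
     feasible k I A' \<and> (\<forall>B. feasible k I B \<longrightarrow> sum (cost I) A' \<le> sum (cost I) B)"


section \<open>The machine model\<close>

text \<open>
  A random access machine with structured programs. Its memory consists of arrays of natural
  numbers and arrays of real numbers; array names are fixed in the program text, so that a program
  uses only finitely many arrays, while indices are computed. (A scalar variable is an array of
  which only index 0 is used.) Real numbers are handled exactly, but can only be added, subtracted
  and compared. Every elementary operation has cost one.

  There is deliberately no multiplication (nor rounding of reals): a run of cost t can increase
  numbers at most by the factor 2 ^ t, and rational data keep their common denominator, see
  \<^emph>\<open>run_bounded\<close> below. On rational input a polynomial bound on the unit cost is therefore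
  also a polynomial bound in the usual bit model.
\<close>

record state =
  nmem :: "nat \<Rightarrow> nat \<Rightarrow> nat"
  rmem :: "nat \<Rightarrow> nat \<Rightarrow> real"

datatype nexp = Num nat | NAt nat nexp | NAdd nexp nexp | NSub nexp nexp

datatype rexp = RZero | RAt nat nexp | RAdd rexp rexp | RSub rexp rexp

datatype bexp = NLess nexp nexp | RLess rexp rexp | BNot bexp | BAnd bexp bexp

datatype com =
    Skip
  | NStore nat nexp nexp
  | RStore nat nexp rexp
  | Seq com com
  | Cond bexp com com
  | While bexp com

fun nval :: "nexp \<Rightarrow> state \<Rightarrow> nat" where
  "nval (Num n) \<sigma> = n"
| "nval (NAt a e) \<sigma> = nmem \<sigma> a (nval e \<sigma>)"
| "nval (NAdd e f) \<sigma> = nval e \<sigma> + nval f \<sigma>"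
| "nval (NSub e f) \<sigma> = nval e \<sigma> - nval f \<sigma>"

fun rval :: "rexp \<Rightarrow> state \<Rightarrow> real" where
  "rval RZero \<sigma> = 0"
| "rval (RAt a e) \<sigma> = rmem \<sigma> a (nval e \<sigma>)"
| "rval (RAdd e f) \<sigma> = rval e \<sigma> + rval f \<sigma>"
| "rval (RSub e f) \<sigma> = rval e \<sigma> - rval f \<sigma>"

fun bval :: "bexp \<Rightarrow> state \<Rightarrow> bool" where
  "bval (NLess e f) \<sigma> \<longleftrightarrow> nval e \<sigma> < nval f \<sigma>"
| "bval (RLess e f) \<sigma> \<longleftrightarrow> rval e \<sigma> < rval f \<sigma>"
| "bval (BNot b) \<sigma> \<longleftrightarrow> \<not> bval b \<sigma>"
| "bval (BAnd b d) \<sigma> \<longleftrightarrow> bval b \<sigma> \<and> bval d \<sigma>"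

text \<open>
  A numeral n is charged like a sum of n ones; numerals are part of the program, so this is a
  constant.
\<close>

fun ncost :: "nexp \<Rightarrow> nat" where
  "ncost (Num n) = n + 1"
| "ncost (NAt a e) = ncost e + 1"
| "ncost (NAdd e f) = ncost e + ncost f + 1"
| "ncost (NSub e f) = ncost e + ncost f + 1"

fun rcost :: "rexp \<Rightarrow> nat" where
  "rcost RZero = 1"
| "rcost (RAt a e) = ncost e + 1"
| "rcost (RAdd e f) = rcost e + rcost f + 1"
| "rcost (RSub e f) = rcost e + rcost f + 1"

fun bcost :: "bexp \<Rightarrow> nat" where
  "bcost (NLess e f) = ncost e + ncost f + 1"
| "bcost (RLess e f) = rcost e + rcost f + 1"
| "bcost (BNot b) = bcost b + 1"
| "bcost (BAnd b d) = bcost b + bcost d + 1"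

definition nstore :: "nat \<Rightarrow> nat \<Rightarrow> nat \<Rightarrow> state \<Rightarrow> state" where
  "nstore a i x \<sigma> = \<sigma>\<lparr>nmem := (nmem \<sigma>)(a := (nmem \<sigma> a)(i := x))\<rparr>"

definition rstore :: "nat \<Rightarrow> nat \<Rightarrow> real \<Rightarrow> state \<Rightarrow> state" where
  "rstore a i x \<sigma> = \<sigma>\<lparr>rmem := (rmem \<sigma>)(a := (rmem \<sigma> a)(i := x))\<rparr>"

text \<open>\<^emph>\<open>run P \<sigma> t \<tau>\<close>: started in \<sigma>, the program P halts in state \<tau> after t steps.\<close>

inductive run :: "com \<Rightarrow> state \<Rightarrow> nat \<Rightarrow> state \<Rightarrow> bool" where
  Skip: "run Skip \<sigma> 1 \<sigma>"
| NStore: "run (NStore a e f) \<sigma> (ncost e + ncost f + 1) (nstore a (nval e \<sigma>) (nval f \<sigma>) \<sigma>)"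
| RStore: "run (RStore a e f) \<sigma> (ncost e + rcost f + 1) (rstore a (nval e \<sigma>) (rval f \<sigma>) \<sigma>)"
| Seq: "run P \<sigma> t \<sigma>' \<Longrightarrow> run Q \<sigma>' t' \<sigma>'' \<Longrightarrow> run (Seq P Q) \<sigma> (t + t') \<sigma>''"
| CondTrue: "bval b \<sigma> \<Longrightarrow> run P \<sigma> t \<sigma>' \<Longrightarrow> run (Cond b P Q) \<sigma> (bcost b + t) \<sigma>'"
| CondFalse: "\<not> bval b \<sigma> \<Longrightarrow> run Q \<sigma> t \<sigma>' \<Longrightarrow> run (Cond b P Q) \<sigma> (bcost b + t) \<sigma>'"
| WhileFalse: "\<not> bval b \<sigma> \<Longrightarrow> run (While b P) \<sigma> (bcost b) \<sigma>"
| WhileTrue: "bval b \<sigma> \<Longrightarrow> run P \<sigma> t \<sigma>' \<Longrightarrow> run (While b P) \<sigma>' t' \<sigma>'' \<Longrightarrow>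
    run (While b P) \<sigma> (bcost b + t + t') \<sigma>''"

inductive_cases SkipE: "run Skip \<sigma> t \<tau>"
inductive_cases NStoreE: "run (NStore a e f) \<sigma> t \<tau>"
inductive_cases RStoreE: "run (RStore a e f) \<sigma> t \<tau>"
inductive_cases SeqE: "run (Seq P Q) \<sigma> t \<tau>"
inductive_cases CondE: "run (Cond b P Q) \<sigma> t \<tau>"
inductive_cases WhileE: "run (While b P) \<sigma> t \<tau>"

lemma run_deterministic:
  assumes "run P \<sigma> t \<tau>" and "run P \<sigma> t' \<tau>'"
  shows "t = t' \<and> \<tau> = \<tau>'"
  using assms
proof (induction arbitrary: t' \<tau>' rule: run.induct)
  case (Skip \<sigma>)
  then show ?case by (auto elim: SkipE)
next
  case (NStore a e f \<sigma>)
  then show ?case by (auto elim: NStoreE)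
next
  case (RStore a e f \<sigma>)
  then show ?case by (auto elim: RStoreE)
next
  case (Seq P \<sigma> t \<sigma>' Q u \<sigma>'')
  from Seq.prems show ?case
    by (rule SeqE) (use Seq.IH in blast)
next
  case (CondTrue b \<sigma> P t \<sigma>' Q)
  from CondTrue.prems show ?case
    by (rule CondE) (use CondTrue.hyps(1) CondTrue.IH in blast)+
next
  case (CondFalse b \<sigma> Q t \<sigma>' P)
  from CondFalse.prems show ?case
    by (rule CondE) (use CondFalse.hyps(1) CondFalse.IH in blast)+
next
  case (WhileFalse b \<sigma> P)
  from WhileFalse.prems show ?case
    by (rule WhileE) (use WhileFalse.hyps in blast)+
next
  case (WhileTrue b \<sigma> P t \<sigma>' u \<sigma>'')
  from WhileTrue.prems show ?case
    by (rule WhileE) (use WhileTrue.hyps(1) WhileTrue.IH in blast)+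
qed

text \<open>All numbers are at most B, where reals are measured in multiples of the unit d.\<close>

definition bounded_state :: "real \<Rightarrow> nat \<Rightarrow> state \<Rightarrow> bool" where
  "bounded_state d B \<sigma> \<longleftrightarrow>
     (\<forall>a i. nmem \<sigma> a i \<le> B) \<and> (\<forall>a i. \<exists>z. rmem \<sigma> a i = of_int z * d \<and> \<bar>z\<bar> \<le> int B)"

lemma pow_add_bound: "(2::nat) ^ m * B + 2 ^ n * B \<le> 2 ^ (m + n + 1) * B"
proof -
  have "(2::nat) ^ m \<le> 2 ^ (m + n)" "(2::nat) ^ n \<le> 2 ^ (m + n)"
    by (auto intro: power_increasing)
  then have "(2::nat) ^ m + 2 ^ n \<le> 2 ^ (m + n + 1)"
    unfolding power_Suc Suc_eq_plus1[symmetric] by linarith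
  from mult_le_mono1[OF this, of B] show ?thesis
    by (simp only: add_mult_distrib)
qed

lemma nval_bounded:
  assumes "bounded_state d B \<sigma>" and "1 \<le> B"
  shows "nval e \<sigma> \<le> 2 ^ ncost e * B"
proof (induction e)
  case (Num n)
  have "n \<le> n * B"
    using assms(2) by simp
  also have "\<dots> \<le> 2 ^ ncost (Num n) * B"
    using less_exp[of "n + 1"] by (intro mult_le_mono1) simp
  finally show ?case by simp
next
  case (NAt a e)
  have "nmem \<sigma> a (nval e \<sigma>) \<le> B"
    using assms(1) by (simp add: bounded_state_def)
  also have "B \<le> 2 ^ ncost (NAt a e) * B"
    by simp
  finally show ?case by simp
next
  case (NAdd e f)
  then have "nval (NAdd e f) \<sigma> \<le> 2 ^ ncost e * B + 2 ^ ncost f * B"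
    by simp
  also note pow_add_bound
  finally show ?case by simp
next
  case (NSub e f)
  then have "nval (NSub e f) \<sigma> \<le> 2 ^ ncost e * B + 2 ^ ncost f * B"
    by simp
  also note pow_add_bound
  finally show ?case by simp
qed

lemma rval_bounded:
  assumes "bounded_state d B \<sigma>"
  shows "\<exists>z. rval e \<sigma> = of_int z * d \<and> \<bar>z\<bar> \<le> int (2 ^ rcost e * B)"
proof (induction e)
  case RZero
  show ?case by (rule exI[of _ 0]) simp
next
  case (RAt a e)
  obtain z where z: "rmem \<sigma> a (nval e \<sigma>) = of_int z * d" "\<bar>z\<bar> \<le> int B"
    using assms unfolding bounded_state_def by blast
  have "B \<le> 2 ^ rcost (RAt a e) * B"
    by simp
  then have "int B \<le> int (2 ^ rcost (RAt a e) * B)"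
    by (rule zle_int[THEN iffD2])
  with z show ?case by (intro exI[of _ z]) simp
next
  case (RAdd e f)
  then obtain y z where yz: "rval e \<sigma> = of_int y * d" "\<bar>y\<bar> \<le> int (2 ^ rcost e * B)"
    "rval f \<sigma> = of_int z * d" "\<bar>z\<bar> \<le> int (2 ^ rcost f * B)" by blast
  have "\<bar>y + z\<bar> \<le> int (2 ^ rcost e * B + 2 ^ rcost f * B)"
    using yz(2,4) by linarith
  also have "\<dots> \<le> int (2 ^ rcost (RAdd e f) * B)"
    using pow_add_bound[of "rcost e" B "rcost f"] by (simp only: zle_int rcost.simps)
  finally show ?case using yz(1,3) by (intro exI[of _ "y + z"]) (simp add: algebra_simps)
next
  case (RSub e f)
  then obtain y z where yz: "rval e \<sigma> = of_int y * d" "\<bar>y\<bar> \<le> int (2 ^ rcost e * B)"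
    "rval f \<sigma> = of_int z * d" "\<bar>z\<bar> \<le> int (2 ^ rcost f * B)" by blast
  have "\<bar>y - z\<bar> \<le> int (2 ^ rcost e * B + 2 ^ rcost f * B)"
    using yz(2,4) by linarith
  also have "\<dots> \<le> int (2 ^ rcost (RSub e f) * B)"
    using pow_add_bound[of "rcost e" B "rcost f"] by (simp only: zle_int rcost.simps)
  finally show ?case using yz(1,3) by (intro exI[of _ "y - z"]) (simp add: algebra_simps)
qed

lemma bounded_state_mono:
  assumes "bounded_state d B \<sigma>" and "B \<le> C"
  shows "bounded_state d C \<sigma>"
  unfolding bounded_state_def
proof (intro conjI allI)
  fix a i
  show "nmem \<sigma> a i \<le> C"
    using assms unfolding bounded_state_def by (meson le_trans)
  obtain z where "rmem \<sigma> a i = of_int z * d" "\<bar>z\<bar> \<le> int B"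
    using assms(1) unfolding bounded_state_def by blast
  with assms(2) show "\<exists>z. rmem \<sigma> a i = of_int z * d \<and> \<bar>z\<bar> \<le> int C"
    by (intro exI[of _ z]) linarith
qed

lemma bounded_state_pow:
  assumes "bounded_state d (2 ^ m * B) \<sigma>" and "m \<le> n"
  shows "bounded_state d (2 ^ n * B) \<sigma>"
  using assms(1) by (rule bounded_state_mono) (simp add: assms(2) power_increasing)

theorem run_bounded:
  assumes "run P \<sigma> t \<tau>" and "bounded_state d B \<sigma>" and "1 \<le> B"
  shows "bounded_state d (2 ^ t * B) \<tau>"
  using assms
proof (induction arbitrary: B rule: run.induct)
  case (Skip \<sigma>)
  then show ?case using bounded_state_pow[of d 0 B \<sigma> 1] by simp
next
  case (NStore a e f \<sigma>)
  let ?C = "2 ^ (ncost e + ncost f + 1) * B"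
  have "bounded_state d ?C \<sigma>"
    using bounded_state_pow[of d 0 B \<sigma> "ncost e + ncost f + 1"] NStore.prems(1) by simp
  moreover have "nval f \<sigma> \<le> ?C"
    using nval_bounded[OF NStore.prems, of f]
    by (rule le_trans) (intro mult_le_mono1 power_increasing, auto)
  ultimately show ?case
    by (simp add: bounded_state_def nstore_def)
next
  case (RStore a e f \<sigma>)
  let ?C = "2 ^ (ncost e + rcost f + 1) * B"
  have C: "bounded_state d ?C \<sigma>"
    using bounded_state_pow[of d 0 B \<sigma> "ncost e + rcost f + 1"] RStore.prems(1) by simp
  obtain z where z: "rval f \<sigma> = of_int z * d" "\<bar>z\<bar> \<le> int (2 ^ rcost f * B)"
    using rval_bounded[OF RStore.prems(1)] by blast
  have "2 ^ rcost f * B \<le> ?C"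
    by (intro mult_le_mono1 power_increasing) auto
  then have "int (2 ^ rcost f * B) \<le> int ?C"
    by (rule zle_int[THEN iffD2])
  with z(2) have "\<bar>z\<bar> \<le> int ?C"
    by (rule order_trans)
  with z(1) C show ?case
    unfolding bounded_state_def rstore_def by (auto simp del: of_nat_mult of_nat_power)
next
  case (Seq P \<sigma> t \<sigma>' Q t' \<sigma>'')
  have "bounded_state d (2 ^ t' * (2 ^ t * B)) \<sigma>''"
    using Seq.IH(2)[OF Seq.IH(1)[OF Seq.prems]] Seq.prems(2) by simp
  then show ?case by (simp add: power_add ac_simps)
next
  case (CondTrue b \<sigma> P t \<sigma>' Q)
  then show ?case using bounded_state_pow[of d t B \<sigma>' "bcost b + t"] by simp
next
  case (CondFalse b \<sigma> Q t \<sigma>' P)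
  then show ?case using bounded_state_pow[of d t B \<sigma>' "bcost b + t"] by simp
next
  case (WhileFalse b \<sigma> P)
  then show ?case using bounded_state_pow[of d 0 B \<sigma> "bcost b"] by simp
next
  case (WhileTrue b \<sigma> P t \<sigma>' t' \<sigma>'')
  have "bounded_state d (2 ^ t' * (2 ^ t * B)) \<sigma>''"
    using WhileTrue.IH(2)[OF WhileTrue.IH(1)[OF WhileTrue.prems]] WhileTrue.prems(2) by simp
  then have "bounded_state d (2 ^ (t + t') * B) \<sigma>''"
    by (simp add: power_add ac_simps)
  then show ?case by (rule bounded_state_pow) simp
qed

text \<open>
  One program solves all instances \<^emph>\<open>x \<in> X\<close>, presented through the encoding \<^emph>\<open>enc\<close>, in
  time polynomial in their size; \<^emph>\<open>answers x\<close> says which final states are correct.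
\<close>

definition poly_time_solvable ::
  "'i set \<Rightarrow> ('i \<Rightarrow> state) \<Rightarrow> ('i \<Rightarrow> nat) \<Rightarrow> ('i \<Rightarrow> state \<Rightarrow> bool) \<Rightarrow> bool" where
  "poly_time_solvable X enc sz answers \<longleftrightarrow>
     (\<exists>(P::com) (p::nat poly). \<forall>x\<in>X. \<exists>t \<tau>.
        run P (enc x) t \<tau> \<and> t \<le> poly p (sz x) \<and> answers x \<tau>)"


section \<open>Instances as machine input\<close>

text \<open>
  As input of an algorithm, a digraph has vertices 0, ..., n - 1 and arcs 0, ..., m - 1, numbered
  arbitrarily. The number k of colour classes is constant, so n + m is the size of an instance up
  to a constant factor.
\<close>

type_synonym input = "(nat, nat) ssd_instance"

definition numbered :: "input \<Rightarrow> bool" where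
  "numbered I \<longleftrightarrow>
     verts (graph I) = {..<card (verts (graph I))} \<and> arcs (graph I) = {..<card (arcs (graph I))}"

definition input_size :: "input \<Rightarrow> nat" where
  "input_size I = card (verts (graph I)) + card (arcs (graph I))"

text \<open>
  Array 0 holds n, m, s, t; arrays 1 and 2 the tails and heads of the arcs; array 2 + i the
  characteristic function of colour class i; the costs are in real array 0. All other cells are 0.
\<close>

definition encode :: "nat \<Rightarrow> input \<Rightarrow> state" where
  "encode k I =
     (let n = card (verts (graph I)); m = card (arcs (graph I)) in
      \<lparr>nmem = (\<lambda>a j.
         if a = 0 then
           (if j = 0 then n else if j = 1 then m
            else if j = 2 then source I else if j = 3 then target I else 0)
         else if a = 1 \<and> j < m then tail (graph I) j
         else if a = 2 \<and> j < m then head (graph I) j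
         else if 3 \<le> a \<and> a \<le> k + 2 \<and> j < m then of_bool (j \<in> colour_class I (a - 2))
         else 0),
       rmem = (\<lambda>a j. if a = 0 \<and> j < m then cost I j else 0)\<rparr>)"

text \<open>
  Cell 0 of array 0 must tell whether there is a feasible arc set; if so, array 1 must contain the
  characteristic function of an optimal one.
\<close>

definition correct_output :: "nat \<Rightarrow> input \<Rightarrow> state \<Rightarrow> bool" where
  "correct_output k I \<tau> \<longleftrightarrow>
     (if \<exists>A'. feasible k I A'
      then nmem \<tau> 0 0 = 1 \<and> optimal k I {j \<in> arcs (graph I). nmem \<tau> 1 j = 1}
      else nmem \<tau> 0 0 = 0)"

end

theory Submission
  imports Defs "HOL-Library.Product_Lexorder"
begin

text \<open>
  All arcs of negative cost may be put into the answer, after which only the positive part of the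
  cost matters. List the arcs by increasing height of their tail, where the height of a vertex is
  the length of a longest walk starting there. Every walk traverses its arcs against this order, so
  a walk within the first g + 1 arcs can use the last of these only as its first arc. Hence a
  dynamic program over g and over the current positions of k walkers suffices: for the next arc,
  decide which of the walkers that stand at its tail, and may use it by colour, cross it; its cost
  is paid once however many of them do. There are (m + 1) n ^ k states. Infeasibility is the first
  component of a lexicographically ordered cost, so that every state has a finite value.
\<close>

text \<open>The obstacle is that the costs of overlapping paths do not add up. Treating each arc at
  a single stage removes it: all walkers that share the arc cross it at that stage, so the joint
  cost splits over the stages. The layers measure the way from a state to the target; every stage
  peels off first arcs and need not know how the walkers reached their positions. Acyclicity enters
  in three ways: heights are below \<open>n\<close>, a walk never returns to an arc, and an arc
  never ends where it starts, which permits updating a table in place. The machine explains much of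
  the rest. It can neither multiply nor divide, so the digits of states and the multiples of powers
  of \<open>n\<close> are tabulated by additions and subtractions. Loops over vertices, arcs and
  states are counted at run time; loops over the walkers are unrolled in the program text, which is
  possible because \<open>k\<close> is constant.\<close>

section \<open>Polynomial-time Hoare triples\<close>

text \<open>The polynomial is chosen before the parameter x, which will be the instance: a triple asserts
  a time bound that is uniform in x, and no explicit running time is ever computed.\<close>

definition tri ::
  "('x \<Rightarrow> nat) \<Rightarrow> ('x \<Rightarrow> state \<Rightarrow> bool) \<Rightarrow> com \<Rightarrow> ('x \<Rightarrow> state \<Rightarrow> bool) \<Rightarrow> bool" where
  "tri sz A P B \<longleftrightarrow>
     (\<exists>p::nat poly. \<forall>x \<sigma>. A x \<sigma> \<longrightarrow> (\<exists>t \<tau>. run P \<sigma> t \<tau> \<and> t \<le> poly p (sz x) \<and> B x \<tau>))"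

lemma tri_conseq:
  assumes "tri sz A P B" and "\<And>x \<sigma>. A' x \<sigma> \<Longrightarrow> A x \<sigma>" and "\<And>x \<sigma>. B x \<sigma> \<Longrightarrow> B' x \<sigma>"
  shows "tri sz A' P B'"
  using assms unfolding tri_def by meson

lemma tri_Seq [intro]:
  assumes "tri sz A P B" and "tri sz B Q C"
  shows "tri sz A (Seq P Q) C"
proof -
  obtain p :: "nat poly" where p: "\<forall>x \<sigma>. A x \<sigma> \<longrightarrow> (\<exists>t \<tau>. run P \<sigma> t \<tau> \<and> t \<le> poly p (sz x) \<and> B x \<tau>)"
    using assms(1) unfolding tri_def by blast
  obtain q :: "nat poly" where q: "\<forall>x \<sigma>. B x \<sigma> \<longrightarrow> (\<exists>t \<tau>. run Q \<sigma> t \<tau> \<and> t \<le> poly q (sz x) \<and> C x \<tau>)"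
    using assms(2) unfolding tri_def by blast
  have "\<exists>t \<tau>. run (Seq P Q) \<sigma> t \<tau> \<and> t \<le> poly (p + q) (sz x) \<and> C x \<tau>" if A: "A x \<sigma>" for x \<sigma>
  proof -
    obtain t \<tau> where 1: "run P \<sigma> t \<tau>" "t \<le> poly p (sz x)" "B x \<tau>"
      using p A by blast
    obtain t' \<tau>' where 2: "run Q \<tau> t' \<tau>'" "t' \<le> poly q (sz x)" "C x \<tau>'"
      using q 1(3) by blast
    show ?thesis
      using run.Seq[OF 1(1) 2(1)] 1(2) 2(2,3) by (intro exI[of _ "t + t'"] exI[of _ \<tau>']) simp
  qed
  then show ?thesis unfolding tri_def by blast
qed

section \<open>Loop-free programs and frame conditions\<close>

fun loop_free :: "com \<Rightarrow> bool" where
  "loop_free (Seq P Q) \<longleftrightarrow> loop_free P \<and> loop_free Q"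
| "loop_free (Cond b P Q) \<longleftrightarrow> loop_free P \<and> loop_free Q"
| "loop_free (While b P) \<longleftrightarrow> False"
| "loop_free _ \<longleftrightarrow> True"

text \<open>A default value for loops makes the function total; it describes runs of loop-free
  programs, for which a triple becomes a rewriting problem.\<close>

fun exec :: "com \<Rightarrow> state \<Rightarrow> state" where
  "exec Skip \<sigma> = \<sigma>"
| "exec (NStore a e f) \<sigma> = nstore a (nval e \<sigma>) (nval f \<sigma>) \<sigma>"
| "exec (RStore a e f) \<sigma> = rstore a (nval e \<sigma>) (rval f \<sigma>) \<sigma>"
| "exec (Seq P Q) \<sigma> = exec Q (exec P \<sigma>)"
| "exec (Cond b P Q) \<sigma> = (if bval b \<sigma> then exec P \<sigma> else exec Q \<sigma>)"
| "exec (While b P) \<sigma> = \<sigma>"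

text \<open>Expression costs do not depend on the state and there are finitely many branches, so one
  constant bounds all runs.\<close>

lemma run_loop_free:
  assumes "loop_free P"
  shows "\<exists>T. \<forall>\<sigma>. \<exists>t\<le>T. run P \<sigma> t (exec P \<sigma>)"
  using assms
proof (induction P)
  case (Seq P Q)
  then obtain T T' where *: "\<And>\<sigma>. \<exists>t\<le>T. run P \<sigma> t (exec P \<sigma>)"
    "\<And>\<sigma>. \<exists>t\<le>T'. run Q \<sigma> t (exec Q \<sigma>)" by auto
  have "\<exists>t\<le>T + T'. run (Seq P Q) \<sigma> t (exec (Seq P Q) \<sigma>)" for \<sigma>
  proof -
    obtain t t' where "t \<le> T" "run P \<sigma> t (exec P \<sigma>)" "t' \<le> T'"
      "run Q (exec P \<sigma>) t' (exec Q (exec P \<sigma>))" using * by meson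
    then show ?thesis by (intro exI[of _ "t + t'"]) (auto intro: run.Seq)
  qed
  then show ?case by blast
next
  case (Cond b P Q)
  then obtain T T' where *: "\<And>\<sigma>. \<exists>t\<le>T. run P \<sigma> t (exec P \<sigma>)"
    "\<And>\<sigma>. \<exists>t\<le>T'. run Q \<sigma> t (exec Q \<sigma>)" by auto
  have "\<exists>t\<le>bcost b + T + T'. run (Cond b P Q) \<sigma> t (exec (Cond b P Q) \<sigma>)" for \<sigma>
  proof (cases "bval b \<sigma>")
    case True
    obtain t where "t \<le> T" "run P \<sigma> t (exec P \<sigma>)" using * by meson
    with True show ?thesis by (intro exI[of _ "bcost b + t"]) (auto intro: run.CondTrue)
  next
    case False
    obtain t where "t \<le> T'" "run Q \<sigma> t (exec Q \<sigma>)" using * by meson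
    with False show ?thesis by (intro exI[of _ "bcost b + t"]) (auto intro: run.CondFalse)
  qed
  then show ?case by blast
qed (fastforce intro: run.intros)+

lemma tri_exec:
  assumes "loop_free P" and "\<And>x \<sigma>. A x \<sigma> \<Longrightarrow> B x (exec P \<sigma>)"
  shows "tri sz A P B"
proof -
  obtain T where "\<And>\<sigma>. \<exists>t\<le>T. run P \<sigma> t (exec P \<sigma>)"
    using run_loop_free[OF assms(1)] by blast
  with assms(2) show ?thesis
    unfolding tri_def by (intro exI[of _ "[:T:]"]) fastforce
qed

text \<open>A sufficient condition for invariance that ignores guards: each single assignment
  preserves \<open>R\<close> in every state with \<open>R\<close>. It gives frames for whole loops
  without loop invariants.\<close>

fun stable :: "(state \<Rightarrow> bool) \<Rightarrow> com \<Rightarrow> bool" where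
  "stable R Skip \<longleftrightarrow> True"
| "stable R (NStore a e f) \<longleftrightarrow> (\<forall>\<sigma>. R \<sigma> \<longrightarrow> R (nstore a (nval e \<sigma>) (nval f \<sigma>) \<sigma>))"
| "stable R (RStore a e f) \<longleftrightarrow> (\<forall>\<sigma>. R \<sigma> \<longrightarrow> R (rstore a (nval e \<sigma>) (rval f \<sigma>) \<sigma>))"
| "stable R (Seq P Q) \<longleftrightarrow> stable R P \<and> stable R Q"
| "stable R (Cond b P Q) \<longleftrightarrow> stable R P \<and> stable R Q"
| "stable R (While b P) \<longleftrightarrow> stable R P"

lemma run_stable: "run P \<sigma> t \<tau> \<Longrightarrow> stable R P \<Longrightarrow> R \<sigma> \<Longrightarrow> R \<tau>"
  by (induction rule: run.induct) auto

lemma tri_frame: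
  assumes "tri sz (\<lambda>x \<sigma>. A x \<sigma> \<and> R x \<sigma>) P B" and "\<And>x. stable (R x) P"
  shows "tri sz (\<lambda>x \<sigma>. A x \<sigma> \<and> R x \<sigma>) P (\<lambda>x \<sigma>. B x \<sigma> \<and> R x \<sigma>)"
  using assms run_stable unfolding tri_def by meson

section \<open>Counting loops and unrolled loops\<close>

abbreviation V :: "nat \<Rightarrow> nexp" where "V c \<equiv> NAt 0 (Num c)"
abbreviation sv :: "state \<Rightarrow> nat \<Rightarrow> nat" where "sv \<sigma> c \<equiv> nmem \<sigma> 0 c"

text \<open>The bound \<open>e\<close> is evaluated anew at every test, so \<open>tri_For\<close>
  asks for a predicate \<open>R\<close> that fixes its value.\<close>

definition For :: "nat \<Rightarrow> nexp \<Rightarrow> com \<Rightarrow> com" where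
  "For c e P = Seq (NStore 0 (Num c) (Num 0))
     (While (NLess (V c) e) (Seq P (NStore 0 (Num c) (NAdd (V c) (Num 1)))))"

text \<open>Induction on the number of remaining rounds. A test costs \<open>c + ncost e + 3\<close>
  and an increment \<open>2 * c + 7\<close>, so the constant 20 leaves slack; the \<open>Suc\<close>
  in the bound pays for the failing last test.\<close>

lemma run_While_counter:
  assumes body: "\<And>\<sigma>. R \<sigma> \<Longrightarrow> Inv \<sigma> \<Longrightarrow> sv \<sigma> c < N \<Longrightarrow>
      \<exists>t \<tau>. run P \<sigma> t \<tau> \<and> t \<le> T \<and> Inv (nstore 0 c (Suc (sv \<sigma> c)) \<tau>) \<and> sv \<tau> c = sv \<sigma> c \<and> R \<tau>"
    and R: "\<And>\<sigma> v. R \<sigma> \<Longrightarrow> R (nstore 0 c v \<sigma>)"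
    and bound: "\<And>\<sigma>. R \<sigma> \<Longrightarrow> nval e \<sigma> = N"
    and start: "R \<sigma>" "Inv \<sigma>" "sv \<sigma> c \<le> N"
  shows "\<exists>t \<tau>. run (While (NLess (V c) e) (Seq P (NStore 0 (Num c) (NAdd (V c) (Num 1))))) \<sigma> t \<tau> \<and>
    t \<le> Suc (N - sv \<sigma> c) * (T + 3 * c + ncost e + 20) \<and> R \<tau> \<and> Inv \<tau> \<and> sv \<tau> c = N"
  using start
proof (induction "N - sv \<sigma> c" arbitrary: \<sigma>)
  case 0
  then have "sv \<sigma> c = N" "\<not> bval (NLess (V c) e) \<sigma>" using bound by auto
  from run.WhileFalse[OF this(2), of "Seq P (NStore 0 (Num c) (NAdd (V c) (Num 1)))"] this(1) 0
  show ?case by (intro exI[of _ "bcost (NLess (V c) e)"] exI[of _ \<sigma>]) simp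
next
  case (Suc d)
  then have lt: "sv \<sigma> c < N" by simp
  then have b: "bval (NLess (V c) e) \<sigma>" using bound[OF Suc.prems(1)] by simp
  obtain t \<tau> where t: "run P \<sigma> t \<tau>" "t \<le> T" "Inv (nstore 0 c (Suc (sv \<sigma> c)) \<tau>)"
    "sv \<tau> c = sv \<sigma> c" "R \<tau>"
    using body[OF Suc.prems(1,2) lt] by blast
  let ?\<tau> = "nstore 0 c (Suc (sv \<sigma> c)) \<tau>"
  have st: "run (Seq P (NStore 0 (Num c) (NAdd (V c) (Num 1)))) \<sigma> (t + (2 * c + 7)) ?\<tau>"
  proof -
    have "ncost (Num c) + ncost (NAdd (V c) (Num 1)) + 1 = 2 * c + 7" by simp
    with run.NStore[of 0 "Num c" "NAdd (V c) (Num 1)" \<tau>] t(4)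
    have "run (NStore 0 (Num c) (NAdd (V c) (Num 1))) \<tau> (2 * c + 7) ?\<tau>"
      by (simp only: nval.simps add_Suc_right One_nat_def add_0_right)
    with t(1) show ?thesis by (rule run.Seq)
  qed
  have sv: "sv ?\<tau> c = Suc (sv \<sigma> c)" by (simp add: nstore_def)
  have d: "d = N - sv ?\<tau> c" and le: "sv ?\<tau> c \<le> N" using Suc.hyps(2) sv lt by simp_all
  obtain t' \<tau>' where t': "run (While (NLess (V c) e) (Seq P (NStore 0 (Num c) (NAdd (V c) (Num 1))))) ?\<tau> t' \<tau>'"
    "t' \<le> Suc (N - sv ?\<tau> c) * (T + 3 * c + ncost e + 20)"
    "R \<tau>'" "Inv \<tau>'" "sv \<tau>' c = N"
    using Suc.hyps(1)[OF d R[OF t(5)] t(3) le] by blast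
  have "N - sv \<sigma> c = Suc (N - sv ?\<tau> c)" using sv lt by simp
  then have "bcost (NLess (V c) e) + (t + (2 * c + 7)) + t' \<le>
      Suc (N - sv \<sigma> c) * (T + 3 * c + ncost e + 20)"
    using t(2) t'(2) by simp
  with run.WhileTrue[OF b st t'(1)] t'(3-) show ?case by blast
qed

text \<open>The facts about a loop are split: \<open>R\<close> is independent of the counter and
  checked assignment by assignment, \<open>Inv\<close> may depend on the counter and is checked once
  per round. A polynomial number of rounds of polynomial cost is again polynomial.\<close>

lemma tri_For:
  assumes body: "tri sz (\<lambda>x \<sigma>. Inv x \<sigma> \<and> R x \<sigma> \<and> sv \<sigma> c < N x) P
      (\<lambda>x \<sigma>. Inv x (nstore 0 c (Suc (sv \<sigma> c)) \<sigma>))"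
    and frame: "\<And>x. stable (R x) P"
    and counter: "\<And>v. stable (\<lambda>\<sigma>. sv \<sigma> c = v) P"
    and R: "\<And>x \<sigma> v. R x \<sigma> \<Longrightarrow> R x (nstore 0 c v \<sigma>)"
    and bound: "\<And>x \<sigma>. R x \<sigma> \<Longrightarrow> nval e \<sigma> = N x"
    and size: "\<And>x \<sigma>. R x \<sigma> \<Longrightarrow> N x \<le> poly q (sz x)"
    and pre: "\<And>x \<sigma>. A x \<sigma> \<Longrightarrow> Inv x (nstore 0 c 0 \<sigma>)" "\<And>x \<sigma>. A x \<sigma> \<Longrightarrow> R x \<sigma>"
    and post: "\<And>x \<sigma>. Inv x \<sigma> \<Longrightarrow> R x \<sigma> \<Longrightarrow> sv \<sigma> c = N x \<Longrightarrow> B x \<sigma>"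
  shows "tri sz A (For c e P) B"
proof -
  obtain p :: "nat poly" where p: "\<forall>x \<sigma>. Inv x \<sigma> \<and> R x \<sigma> \<and> sv \<sigma> c < N x \<longrightarrow>
      (\<exists>t \<tau>. run P \<sigma> t \<tau> \<and> t \<le> poly p (sz x) \<and> Inv x (nstore 0 c (Suc (sv \<tau> c)) \<tau>))"
    using body unfolding tri_def by blast
  \<comment> \<open>Resetting the counter costs \<open>c + 3\<close>; the factor
    \<open>q + 1\<close> covers the rounds and the failing last test.\<close>
  let ?r = "[:c + 5:] + (q + 1) * (p + [:3 * c + ncost e + 20:])"
  have "\<exists>t \<tau>. run (For c e P) \<sigma> t \<tau> \<and> t \<le> poly ?r (sz x) \<and> B x \<tau>" if A: "A x \<sigma>" for x \<sigma>
  proof -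
    let ?\<sigma> = "nstore 0 c 0 \<sigma>"
    have sv: "sv ?\<sigma> c = 0" by (simp add: nstore_def)
    have *: "\<exists>t \<tau>. run P \<sigma> t \<tau> \<and> t \<le> poly p (sz x) \<and> Inv x (nstore 0 c (Suc (sv \<sigma> c)) \<tau>)
        \<and> sv \<tau> c = sv \<sigma> c \<and> R x \<tau>"
      if "R x \<sigma>" "Inv x \<sigma>" "sv \<sigma> c < N x" for \<sigma>
    proof -
      obtain t \<tau> where t: "run P \<sigma> t \<tau>" "t \<le> poly p (sz x)"
        "Inv x (nstore 0 c (Suc (sv \<tau> c)) \<tau>)"
        using p \<open>R x \<sigma>\<close> \<open>Inv x \<sigma>\<close> \<open>sv \<sigma> c < N x\<close> by blast
      have "R x \<tau>" using run_stable[OF t(1), of "R x"] frame that(1) by blast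
      moreover have "sv \<tau> c = sv \<sigma> c"
        using run_stable[OF t(1), of "\<lambda>\<tau>. sv \<tau> c = sv \<sigma> c"] counter by blast
      ultimately show ?thesis using t by metis
    qed
    have "\<exists>t \<tau>. run (While (NLess (V c) e) (Seq P (NStore 0 (Num c) (NAdd (V c) (Num 1))))) ?\<sigma> t \<tau> \<and>
        t \<le> Suc (N x - sv ?\<sigma> c) * (poly p (sz x) + 3 * c + ncost e + 20) \<and>
        R x \<tau> \<and> Inv x \<tau> \<and> sv \<tau> c = N x"
    proof (rule run_While_counter[where R = "R x" and Inv = "Inv x"])
    qed (use * R bound pre[OF A] sv in auto)
    then obtain t \<tau> where
      t: "run (While (NLess (V c) e) (Seq P (NStore 0 (Num c) (NAdd (V c) (Num 1))))) ?\<sigma> t \<tau>"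
        "t \<le> Suc (N x) * (poly p (sz x) + 3 * c + ncost e + 20)" "R x \<tau>" "Inv x \<tau>" "sv \<tau> c = N x"
      using sv by auto
    have "run (For c e P) \<sigma> (c + 3 + t) \<tau>"
      using run.Seq[OF run.NStore[of 0 "Num c" "Num 0" \<sigma>], of _ t \<tau>] t(1)
      by (simp add: For_def numeral_3_eq_3)
    moreover have "Suc (N x) * (poly p (sz x) + 3 * c + ncost e + 20) \<le>
        (poly q (sz x) + 1) * (poly p (sz x) + 3 * c + ncost e + 20)"
      using size[OF pre(2)[OF A]] by (intro mult_le_mono1) simp
    with t(2) have "c + 3 + t \<le> poly ?r (sz x)" by (simp add: algebra_simps)
    ultimately show ?thesis using post[OF t(4,3,5)] by blast
  qed
  then show ?thesis unfolding tri_def by blast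
qed

lemma stable_For [simp]:
  "stable R (For c e P) \<longleftrightarrow> (\<forall>\<sigma>. R \<sigma> \<longrightarrow> R (nstore 0 c 0 \<sigma>)) \<and> stable R P \<and>
     (\<forall>\<sigma>. R \<sigma> \<longrightarrow> R (nstore 0 c (Suc (sv \<sigma> c)) \<sigma>))"
  by (simp add: For_def)

text \<open>Each walker has arrays of its own and array names cannot be computed, so loops over
  walkers must be written out.\<close>

fun unroll :: "(nat \<Rightarrow> com) \<Rightarrow> nat \<Rightarrow> com" where
  "unroll P 0 = Skip"
| "unroll P (Suc i) = Seq (unroll P i) (P i)"

lemma stable_unroll: "(\<And>i. i < k \<Longrightarrow> stable R (P i)) \<Longrightarrow> stable R (unroll P k)"
  by (induction k) auto

lemma tri_unroll:
  assumes "\<And>i. i < k \<Longrightarrow> tri sz (\<lambda>x \<sigma>. Inv i x \<sigma> \<and> R x \<sigma>) (P i) (Inv (Suc i))"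
    and "\<And>i x. i < k \<Longrightarrow> stable (R x) (P i)"
    and "\<And>x \<sigma>. A x \<sigma> \<Longrightarrow> Inv 0 x \<sigma> \<and> R x \<sigma>"
  shows "tri sz A (unroll P k) (\<lambda>x \<sigma>. Inv k x \<sigma> \<and> R x \<sigma>)"
  using assms(1,2)
proof (induction k)
  case 0
  show ?case using assms(3) by (intro tri_exec) simp_all
next
  case (Suc k)
  have "tri sz A (unroll P k) (\<lambda>x \<sigma>. Inv k x \<sigma> \<and> R x \<sigma>)"
    using Suc by simp
  moreover have "tri sz (\<lambda>x \<sigma>. Inv k x \<sigma> \<and> R x \<sigma>) (P k) (\<lambda>x \<sigma>. Inv (Suc k) x \<sigma> \<and> R x \<sigma>)"
    by (rule tri_frame) (use Suc.prems in auto)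
  ultimately show ?case by auto
qed

definition eq_test :: "nexp \<Rightarrow> nexp \<Rightarrow> bexp" where
  "eq_test e f = BAnd (BNot (NLess e f)) (BNot (NLess f e))"

lemma bval_eq_test [simp]: "bval (eq_test e f) \<sigma> \<longleftrightarrow> nval e \<sigma> = nval f \<sigma>"
  by (auto simp: eq_test_def)

lemma nmem_nstore [simp]:
  "nmem (nstore a i x \<sigma>) b j = (if a = b \<and> i = j then x else nmem \<sigma> b j)"
  by (simp add: nstore_def)

lemma rmem_nstore [simp]: "rmem (nstore a i x \<sigma>) = rmem \<sigma>"
  by (simp add: nstore_def)

lemma rmem_rstore [simp]:
  "rmem (rstore a i x \<sigma>) b j = (if a = b \<and> i = j then x else rmem \<sigma> b j)"
  by (simp add: rstore_def)

lemma nmem_rstore [simp]: "nmem (rstore a i x \<sigma>) = nmem \<sigma>"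
  by (simp add: rstore_def)

section \<open>Moving tuples of walkers\<close>

text \<open>A number below n ^ k encodes the positions of k walkers, the position of walker i being its digit i in base n.\<close>

definition digit :: "nat \<Rightarrow> nat \<Rightarrow> nat \<Rightarrow> nat" where
  "digit n i x = x div n ^ i mod n"

definition index_of :: "nat \<Rightarrow> nat \<Rightarrow> (nat \<Rightarrow> nat) \<Rightarrow> nat" where
  "index_of n k f = (\<Sum>i<k. f i * n ^ i)"

text \<open>The form suits the machine: both products are table entries, so one addition and one
  subtraction replace a digit.\<close>

definition move :: "nat \<Rightarrow> nat \<Rightarrow> nat \<Rightarrow> nat \<Rightarrow> nat" where
  "move n i x w = x + w * n ^ i - digit n i x * n ^ i"

lemma index_of_less:
  assumes "\<And>i. i < k \<Longrightarrow> f i < n"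
  shows "index_of n k f < n ^ k"
  using assms
proof (induction k)
  case 0
  then show ?case by (simp add: index_of_def)
next
  case (Suc k)
  have "f k * n ^ k + n ^ k \<le> n * n ^ k"
    using Suc.prems[of k] by (metis Suc_leI add.commute lessI mult_Suc mult_le_mono1)
  with Suc show ?case by (fastforce simp: index_of_def)
qed

lemma digit_index_of:
  assumes "\<And>i. i < k \<Longrightarrow> f i < n" and "j < k"
  shows "digit n j (index_of n k f) = f j"
  using assms
proof (induction k)
  case (Suc k)
  let ?y = "index_of n k f"
  have y: "?y < n ^ k" using Suc.prems by (intro index_of_less) simp
  have n: "0 < n" using Suc.prems(1)[of 0] by simp
  have S: "index_of n (Suc k) f = ?y + f k * n ^ k" by (simp add: index_of_def)
  show ?case
  proof (cases "j = k")
    case True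
    then show ?thesis using y n Suc.prems(1)[of k] by (simp add: S digit_def)
  next
    case False
    then have "j < k" using Suc.prems by simp
    then obtain d where d: "k = Suc (j + d)" using less_iff_Suc_add by auto
    \<comment> \<open>The leading term is a multiple of \<open>n ^ (j + 1)\<close> and thus does not
      affect digit \<open>j\<close>.\<close>
    have "index_of n (Suc k) f = ?y + (f k * n ^ d * n) * n ^ j"
      unfolding S by (simp add: d power_add algebra_simps)
    then have "digit n j (index_of n (Suc k) f) = digit n j ?y"
      using n by (simp add: digit_def)
    with Suc \<open>j < k\<close> show ?thesis by simp
  qed
qed simp

lemma index_of_digits:
  assumes "x < n ^ k"
  shows "index_of n k (\<lambda>i. digit n i x) = x"
proof -
  have "index_of n k (\<lambda>i. digit n i x) = x mod n ^ k"
  proof (induction k)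
    case (Suc k)
    then show ?case
      using mod_mult2_eq[of x "n ^ k" n]
      by (simp add: index_of_def digit_def algebra_simps)
  qed (simp add: index_of_def)
  with assms show ?thesis by simp
qed

lemma digit_less: "0 < n \<Longrightarrow> digit n i x < n"
  by (simp add: digit_def)

lemma digits_eqI:
  assumes "x < n ^ k" "y < n ^ k" "\<And>i. i < k \<Longrightarrow> digit n i x = digit n i y"
  shows "x = y"
proof -
  have "index_of n k (\<lambda>i. digit n i x) = index_of n k (\<lambda>i. digit n i y)"
    using assms(3) by (simp add: index_of_def)
  then show ?thesis using assms(1,2) by (simp add: index_of_digits)
qed

lemma move_eq_index_of:
  assumes "x < n ^ k" "i < k"
  shows "move n i x w = index_of n k ((\<lambda>j. digit n j x)(i := w))"
proof -
  have *: "{..<k} = insert i ({..<k} - {i})" using assms(2) by auto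
  have 1: "index_of n k ((\<lambda>j. digit n j x)(i := w)) =
      w * n ^ i + (\<Sum>j\<in>{..<k} - {i}. digit n j x * n ^ j)"
    unfolding index_of_def by (subst *, subst sum.insert) auto
  have "index_of n k (\<lambda>j. digit n j x) =
      digit n i x * n ^ i + (\<Sum>j\<in>{..<k} - {i}. digit n j x * n ^ j)"
    unfolding index_of_def by (subst *, subst sum.insert) auto
  with 1 index_of_digits[OF assms(1)] show ?thesis by (simp add: move_def)
qed

lemma
  assumes "x < n ^ k" "i < k" "w < n"
  shows move_less: "move n i x w < n ^ k"
    and digit_move: "j < k \<Longrightarrow> digit n j (move n i x w) = (if j = i then w else digit n j x)"
proof -
  have *: "((\<lambda>j. digit n j x)(i := w)) j < n" for j
    using assms(3) digit_less[of n] by auto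
  show "move n i x w < n ^ k"
    unfolding move_eq_index_of[OF assms(1,2)] using * by (rule index_of_less)
  show "j < k \<Longrightarrow> digit n j (move n i x w) = (if j = i then w else digit n j x)"
    unfolding move_eq_index_of[OF assms(1,2)] using * by (subst digit_index_of) auto
qed

section \<open>Choosing the walkers that cross an arc\<close>

type_synonym penalized = "nat \<times> real"

definition add_cost :: "real \<Rightarrow> penalized \<Rightarrow> penalized" where
  "add_cost c v = (fst v, snd v + c)"

text \<open>Choosing walker by walker whether to cross the arc from u to w (only walkers in \<^emph>\<open>al\<close> may)
  yields the best of all subsets without enumerating them.\<close>

fun best :: "nat \<Rightarrow> (nat \<Rightarrow> bool) \<Rightarrow> nat \<Rightarrow> nat \<Rightarrow> (nat \<Rightarrow> penalized) \<Rightarrow> nat \<Rightarrow> nat \<Rightarrow> nat" where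
  "best n al u w val 0 x = x"
| "best n al u w val (Suc i) x =
     (let y = best n al u w val i (move n i x w); z = best n al u w val i x
      in if digit n i x = u \<and> al i \<and> val y < val z then y else z)"

text \<open>A joint transition from \<open>x\<close> to \<open>y\<close> is the conjunction of this
  over all walkers. They decide independently, which is why \<open>best\<close> may settle them one
  at a time.\<close>

definition reaches :: "nat \<Rightarrow> (nat \<Rightarrow> bool) \<Rightarrow> nat \<Rightarrow> nat \<Rightarrow> nat \<Rightarrow> nat \<Rightarrow> nat \<Rightarrow> bool" where
  "reaches n al u w i x y \<longleftrightarrow>
     digit n i y = digit n i x \<or> digit n i x = u \<and> al i \<and> digit n i y = w"

text \<open>\<open>best\<close> settles the highest walker first and then recurs on the lower ones,
  so the digits from \<open>i\<close> on must be known to stay as they are.\<close>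

lemma best_less_and_reaches:
  assumes "x < n ^ k" "w < n" "i \<le> k"
  shows "best n al u w val i x < n ^ k \<and>
    (\<forall>j<k. if j < i then reaches n al u w j x (best n al u w val i x)
           else digit n j (best n al u w val i x) = digit n j x)"
  using assms
proof (induction i arbitrary: x)
  case (Suc i)
  let ?x = "move n i x w"
  have x: "?x < n ^ k" using Suc.prems by (intro move_less) auto
  note d = digit_move[OF Suc.prems(1) _ Suc.prems(2), of i]
  have z: "best n al u w val i x < n ^ k"
    "\<And>j. j < k \<Longrightarrow> if j < i then reaches n al u w j x (best n al u w val i x)
           else digit n j (best n al u w val i x) = digit n j x"
    using Suc.IH[OF Suc.prems(1,2)] Suc.prems by auto
  have y: "best n al u w val i ?x < n ^ k"
    "\<And>j. j < k \<Longrightarrow> if j < i then reaches n al u w j ?x (best n al u w val i ?x)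
           else digit n j (best n al u w val i ?x) = digit n j ?x"
    using Suc.IH[OF x Suc.prems(2)] Suc.prems by auto
  show ?case
  proof (intro conjI allI impI)
    show "best n al u w val (Suc i) x < n ^ k" using y(1) z(1) by (simp add: Let_def)
    fix j assume j: "j < k"
    show "if j < Suc i then reaches n al u w j x (best n al u w val (Suc i) x)
           else digit n j (best n al u w val (Suc i) x) = digit n j x"
      using y(2)[OF j] z(2)[OF j] d[of j] j Suc.prems(3)
      by (auto simp: Let_def reaches_def less_Suc_eq split: if_splits)
  qed
qed simp

text \<open>In digit \<open>i\<close>, the competitor \<open>y\<close> agrees with \<open>x\<close>
  or with the moved state. Either way it competes in one of the two recursive calls, and the
  comparison keeps the better result.\<close>

lemma best_le:
  assumes "x < n ^ k" "y < n ^ k" "w < n" "i \<le> k"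
    and "\<And>j. j < i \<Longrightarrow> reaches n al u w j x y"
    and "\<And>j. i \<le> j \<Longrightarrow> j < k \<Longrightarrow> digit n j y = digit n j x"
  shows "val (best n al u w val i x) \<le> val y"
  using assms
proof (induction i arbitrary: x)
  case 0
  have "x = y" by (rule digits_eqI[OF 0(1,2)]) (use 0(6) in simp)
  then show ?case by simp
next
  case (Suc i)
  let ?x = "move n i x w"
  have i: "i < k" using Suc.prems by simp
  have x: "?x < n ^ k" using Suc.prems i by (intro move_less) auto
  note d = digit_move[OF Suc.prems(1) i Suc.prems(3)]
  show ?case
  proof (cases "digit n i y = digit n i x")
    case True
    have "val (best n al u w val i x) \<le> val y"
    proof (rule Suc.IH)
      show "digit n j y = digit n j x" if "i \<le> j" "j < k" for j
        using that Suc.prems(6)[of j] True by (cases "i = j") auto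
    qed (use Suc.prems i in auto)
    then show ?thesis by (auto simp: Let_def)
  next
    case False
    with Suc.prems(5)[of i] have *: "digit n i x = u" "al i" "digit n i y = w"
      by (auto simp: reaches_def)
    have "val (best n al u w val i ?x) \<le> val y"
    proof (rule Suc.IH)
      show "reaches n al u w j ?x y" if "j < i" for j
        using that Suc.prems(5)[of j] d[of j] i by (auto simp: reaches_def)
      show "digit n j y = digit n j ?x" if "i \<le> j" "j < k" for j
        using that Suc.prems(6)[of j] *(3) d[of j] by (cases "i = j") auto
    qed (use Suc.prems i x in auto)
    with * show ?thesis by (auto simp: Let_def)
  qed
qed

section \<open>The dynamic program\<close>

abbreviation nv :: "input \<Rightarrow> nat" where "nv I \<equiv> card (verts (graph I))"
abbreviation na :: "input \<Rightarrow> nat" where "na I \<equiv> card (arcs (graph I))"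

definition height :: "input \<Rightarrow> nat \<Rightarrow> nat" where
  "height I v = Max {length p | p. \<exists>w. pre_digraph.awalk (graph I) v p w}"

text \<open>One bucket of a bucket sort. The bound \<open>j\<close> serves the inner loop of
  \<open>sort_arcs\<close>, which has filled only part of the bucket.\<close>

definition arcs_at_height :: "input \<Rightarrow> nat \<Rightarrow> nat \<Rightarrow> nat list" where
  "arcs_at_height I h j = filter (\<lambda>a. height I (tail (graph I) a) = h) [0..<j]"

definition arcs_below :: "input \<Rightarrow> nat \<Rightarrow> nat list" where
  "arcs_below I h = concat (map (\<lambda>h. arcs_at_height I h (na I)) [0..<h])"

lemma arcs_below_Suc: "arcs_below I (Suc h) = arcs_below I h @ arcs_at_height I h (na I)"
  by (simp add: arcs_below_def)

abbreviation sorted_arcs :: "input \<Rightarrow> nat list" where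
  "sorted_arcs I \<equiv> arcs_below I (nv I)"

definition pos_cost :: "input \<Rightarrow> nat \<Rightarrow> real" where
  "pos_cost I a = max 0 (cost I a)"

text \<open>Walkers are counted from 0 and colours from 1, hence the \<open>Suc\<close>. The
  argument before the last limits the choice to the lower walkers, as in the successive rounds of
  the program.\<close>

definition candidate :: "nat \<Rightarrow> input \<Rightarrow> nat \<Rightarrow> (nat \<Rightarrow> penalized) \<Rightarrow> nat \<Rightarrow> nat \<Rightarrow> nat" where
  "candidate k I a = best (nv I) (\<lambda>i. a \<in> colour_class I (Suc i)) (tail (graph I) a) (head (graph I) a)"

text \<open>The value \<open>x\<close> encodes that the arc is not bought. This is unambiguous:
  costs are nonnegative, so a candidate equal to \<open>x\<close> is never strictly better.\<close>

definition successor :: "nat \<Rightarrow> input \<Rightarrow> nat \<Rightarrow> (nat \<Rightarrow> penalized) \<Rightarrow> nat \<Rightarrow> nat" where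
  "successor k I a val x =
     (let y = candidate k I a val k x in if add_cost (pos_cost I a) (val y) < val x then y else x)"

text \<open>The least penalized cost of bringing all walkers from \<open>x\<close> to the target
  with the first \<open>g\<close> arcs. It is phrased through \<open>successor\<close> so that
  \<open>solution\<close> and the stored successors make the same choices.\<close>

fun layer :: "nat \<Rightarrow> input \<Rightarrow> nat \<Rightarrow> nat \<Rightarrow> penalized" where
  "layer k I 0 x = (of_bool (x \<noteq> index_of (nv I) k (\<lambda>_. target I)), 0)"
| "layer k I (Suc g) x =
     (let a = sorted_arcs I ! g; y = successor k I a (layer k I g) x
      in if y = x then layer k I g x else add_cost (pos_cost I a) (layer k I g y))"

fun solution :: "nat \<Rightarrow> input \<Rightarrow> nat \<Rightarrow> nat \<Rightarrow> nat set" where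
  "solution k I 0 x = {}"
| "solution k I (Suc g) x =
     (let a = sorted_arcs I ! g; y = successor k I a (layer k I g) x
      in if y = x then solution k I g x else insert a (solution k I g y))"

section \<open>Heights and the order of the arcs\<close>

locale acyclic_instance =
  fixes k :: nat and I :: input
  assumes numbered: "numbered I" and valid: "valid_instance k I"
    and acyclic: "acyclic_digraph (graph I)"
begin

sublocale fin_digraph "graph I"
  using valid by (simp add: valid_instance_def)

abbreviation "G \<equiv> graph I"
abbreviation "n \<equiv> nv I"
abbreviation "m \<equiv> na I"

lemma in_verts: "v \<in> verts G \<longleftrightarrow> v < n" and in_arcs: "a \<in> arcs G \<longleftrightarrow> a < m"
  using numbered unfolding numbered_def by blast+

lemma source_less: "source I < n" and target_less: "target I < n"
  using valid in_verts by (auto simp: valid_instance_def)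

lemma tail_less: "a < m \<Longrightarrow> tail G a < n" and head_less: "a < m \<Longrightarrow> head G a < n"
  using in_arcs in_verts tail_in_verts head_in_verts by blast+

text \<open>A repeated vertex would yield a closed walk and hence a cycle, so every walk is a path.
  This makes the maximum in \<open>height\<close> one over a finite set.\<close>

lemma awalk_length_less:
  assumes "awalk v p w"
  shows "length p < n"
proof -
  have "distinct (awalk_verts v p)"
  proof (rule ccontr)
    assume "\<not> distinct (awalk_verts v p)"
    then obtain q where "closed_w q"
      using awalk_not_distinct_decomp[OF assms] by (auto simp: closed_w_def)
    then show False using closed_w_imp_cycle acyclic by (auto simp: acyclic_digraph_def)
  qed
  with assms show ?thesis by (intro length_apath_less) (simp add: apath_def)
qed

lemma finite_walk_lengths: "finite {length p | p. \<exists>w. awalk v p w}"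
  by (rule finite_subset[of _ "{..n}"]) (auto dest: awalk_length_less)

lemma length_le_height: "awalk v p w \<Longrightarrow> length p \<le> height I v"
  unfolding height_def by (rule Max_ge[OF finite_walk_lengths]) blast

lemma height_walk:
  assumes "v < n"
  obtains p w where "awalk v p w" "length p = height I v"
proof -
  have "awalk v [] v" using assms in_verts by (simp add: awalk_Nil_iff)
  then have "{length p | p. \<exists>w. awalk v p w} \<noteq> {}" by blast
  from Max_in[OF finite_walk_lengths this] show ?thesis
    using that unfolding height_def by auto
qed

lemma height_less: "v < n \<Longrightarrow> height I v < n"
  by (metis awalk_length_less height_walk)

lemma height_arc: 
  assumes "a < m" shows "Suc (height I (head G a)) \<le> height I (tail G a)"
proof -
  obtain p w where p: "awalk (head G a) p w" "length p = height I (head G a)"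
    using height_walk[OF head_less[OF assms]] by blast
  then have "awalk (tail G a) (a # p) w"
    using assms in_arcs by (simp add: awalk_Cons_iff)
  from length_le_height[OF this] p(2) show ?thesis by simp
qed

text \<open>The first arc of a longest walk does it, since the remainder must be longest from its
  start. With \<open>height_arc\<close> this is the recursion that \<open>relax_heights\<close>
  iterates.\<close>

lemma height_attained:
  assumes "v < n" "height I v = Suc h"
  shows "\<exists>a<m. tail G a = v \<and> height I (head G a) = h"
proof -
  obtain p w where p: "awalk v p w" "length p = Suc h"
    using height_walk[OF assms(1)] assms(2) by metis
  then obtain a q where q: "p = a # q" by (cases p) auto
  with p have a: "a < m" "tail G a = v" "awalk (head G a) q w" "length q = h"
    using in_arcs by (auto simp: awalk_Cons_iff)
  with length_le_height[OF a(3)] height_arc[OF a(1)] assms(2) show ?thesis by auto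
qed

lemma set_arcs_below: "set (arcs_below I h) = {a. a < m \<and> height I (tail G a) < h}"
  by (auto simp: arcs_below_def arcs_at_height_def)

lemma distinct_arcs_below: "distinct (arcs_below I h)"
proof (induction h)
  case (Suc h)
  then show ?case using set_arcs_below[of h]
    by (auto simp: arcs_below_Suc arcs_at_height_def)
qed (simp add: arcs_below_def)

lemma sorted_arcs_below: "sorted (map (\<lambda>a. height I (tail G a)) (arcs_below I h))"
proof (induction h)
  case (Suc h)
  have "map (\<lambda>a. height I (tail G a)) (arcs_at_height I h m) = 
    replicate (length (arcs_at_height I h m)) h"
    by (rule replicate_eqI) (auto simp: arcs_at_height_def)
  then show ?case using set_arcs_below[of h] Suc
    by (auto simp: arcs_below_Suc sorted_append)
qed (simp add: arcs_below_def)

lemma set_sorted_arcs: "set (sorted_arcs I) = {..<m}"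
  using set_arcs_below[of n] height_less tail_less by auto

lemma length_sorted_arcs: "length (sorted_arcs I) = m"
  using distinct_card[OF distinct_arcs_below[of n]] set_sorted_arcs by simp

lemma sorted_arcs_less: "g < m \<Longrightarrow> sorted_arcs I ! g < m"
  using set_sorted_arcs length_sorted_arcs nth_mem[of g "sorted_arcs I"] by auto

lemma height_sorted_arcs:
  "g \<le> h \<Longrightarrow> h < m \<Longrightarrow> height I (tail G (sorted_arcs I ! g)) \<le> height I (tail G (sorted_arcs I ! h))"
  using sorted_nth_mono[OF sorted_arcs_below[of n], of g h] length_sorted_arcs by simp

section \<open>Soundness and optimality of the layers\<close>

lemma candidate_props:
  assumes "x < n ^ k" "a < m"
  shows "candidate k I a val k x < n ^ k"
    and "i < k \<Longrightarrow> reaches n (\<lambda>i. a \<in> colour_class I (Suc i)) (tail G a) (head G a) i x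
      (candidate k I a val k x)"
  using best_less_and_reaches[OF assms(1) head_less[OF assms(2)], of k] by (auto simp: candidate_def)

lemma successor_less: "x < n ^ k \<Longrightarrow> a < m \<Longrightarrow> successor k I a val x < n ^ k"
  using candidate_props(1) by (simp add: successor_def Let_def)

text \<open>In this form the exception for \<open>y = x\<close> disappears, because adding a
  nonnegative cost never makes a value strictly smaller.\<close>

lemma layer_successor:
  assumes "x < n ^ k"
  shows "layer k I (Suc g) x =
    min (layer k I g x) (add_cost (pos_cost I (sorted_arcs I ! g))
      (layer k I g (candidate k I (sorted_arcs I ! g) (layer k I g) k x)))"
proof -
  have "0 \<le> pos_cost I a" for a by (simp add: pos_cost_def)
  then have "\<not> add_cost (pos_cost I a) v < v" for a v
    by (auto simp: add_cost_def less_prod_def not_less)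
  then show ?thesis by (auto simp: successor_def Let_def min_def not_le)
qed

lemma solution_subset: "g \<le> m \<Longrightarrow> solution k I g x \<subseteq> (!) (sorted_arcs I) ` {..<g}"
proof (induction g arbitrary: x)
  case (Suc g)
  then have "solution k I g y \<subseteq> (!) (sorted_arcs I) ` {..<g}" for y by simp
  then have "solution k I g y \<subseteq> (!) (sorted_arcs I) ` {..<Suc g}" for y
    by (rule order_trans) auto
  then show ?case by (simp add: Let_def)
qed simp

lemma sorted_arcs_notin:
  assumes "g < m" shows "sorted_arcs I ! g \<notin> (!) (sorted_arcs I) ` {..<g}"
  using assms distinct_arcs_below[of n] length_sorted_arcs
  by (auto simp: nth_eq_iff_index_eq)

text \<open>The arc of a stage is absent from all solutions of earlier layers, so each
  \<open>insert\<close> adds exactly its cost.\<close>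

lemma layer_cost:
  assumes "g \<le> m"
  shows "snd (layer k I g x) = sum (pos_cost I) (solution k I g x)"
  using assms
proof (induction g arbitrary: x)
  case (Suc g)
  have "sorted_arcs I ! g \<notin> solution k I g y" for y
    using solution_subset[of g y] sorted_arcs_notin[of g] Suc.prems by auto
  moreover have "finite (solution k I g y)" for y
    using solution_subset[of g y] Suc.prems by (auto intro: finite_subset)
  ultimately show ?case using Suc by (simp add: Let_def add_cost_def)
qed simp

text \<open>Walks are rebuilt stage by stage: a walker that crosses the arc puts it in front of its
  walk from the successor state, while one that stays keeps its walk.\<close>

lemma layer_feasible:
  assumes "g \<le> m" "x < n ^ k" "fst (layer k I g x) = 0" "i < k"
  shows "\<exists>p. awalk (digit n i x) p (target I) \<and> set p \<subseteq> solution k I g x \<inter> colour_class I (Suc i)"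
  using assms(1-3)
proof (induction g arbitrary: x)
  case 0
  then have "x = index_of n k (\<lambda>_. target I)" by (simp split: if_splits)
  then have "digit n i x = target I" using target_less assms(4) by (simp add: digit_index_of)
  then show ?case using target_less in_verts by (intro exI[of _ "[]"]) (simp add: awalk_Nil_iff)
next
  case (Suc g)
  let ?a = "sorted_arcs I ! g"
  let ?y = "successor k I ?a (layer k I g) x"
  have a: "?a < m" using Suc.prems sorted_arcs_less by simp
  show ?case
  proof (cases "?y = x")
    case True
    then show ?thesis using Suc by (simp add: Let_def)
  next
    case False
    then have y: "?y = candidate k I ?a (layer k I g) k x"
      by (auto simp: successor_def Let_def split: if_splits)
    have f: "fst (layer k I g ?y) = 0"
      using Suc.prems(3) False by (simp add: Let_def add_cost_def)
    have ylt: "?y < n ^ k" using successor_less[OF Suc.prems(2) a] .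
    obtain p where p: "awalk (digit n i ?y) p (target I)"
      "set p \<subseteq> solution k I g ?y \<inter> colour_class I (Suc i)"
      using Suc.IH[OF _ ylt f] Suc.prems(1) by auto
    have sol: "solution k I (Suc g) x = insert ?a (solution k I g ?y)"
      using False by (simp add: Let_def)
    consider "digit n i ?y = digit n i x"
      | "digit n i x = tail G ?a" "?a \<in> colour_class I (Suc i)" "digit n i ?y = head G ?a"
      using candidate_props(2)[OF Suc.prems(2) a assms(4)] unfolding reaches_def y by blast
    then show ?thesis
    proof cases
      case 1
      with p sol show ?thesis by auto
    next
      case 2
      then have "awalk (digit n i x) (?a # p) (target I)"
        using p a in_arcs tail_less in_verts by (simp add: awalk_Cons_iff)
      with 2 p sol show ?thesis by (intro exI[of _ "?a # p"]) auto
    qed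
  qed
qed

lemma height_along_walk:
  assumes "awalk v p w" "a \<in> set p"
  shows "height I (tail G a) \<le> height I v"
  using assms
proof (induction p arbitrary: v)
  case (Cons b p)
  then have b: "b < m" "tail G b = v" "awalk (head G b) p w"
    using in_arcs by (auto simp: awalk_Cons_iff)
  show ?case
  proof (cases "a = b")
    case False
    then have "height I (tail G a) \<le> height I (head G b)" using Cons b(3) by simp
    with height_arc[OF b(1)] b(2) show ?thesis by simp
  qed (simp add: b(2))
qed simp

text \<open>An exchange with arbitrary competing walks: those that use the last arc start with it,
  so crossing it simultaneously leads to a state \<open>y\<close> from which the shortened walks
  compete in the previous layer.\<close>

lemma layer_optimal:
  assumes "g \<le> m" "x < n ^ k"
    and "\<And>i. i < k \<Longrightarrow> awalk (digit n i x) (p i) (target I)"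
    and "\<And>i. i < k \<Longrightarrow> set (p i) \<subseteq> (!) (sorted_arcs I) ` {..<g} \<inter> colour_class I (Suc i)"
  shows "layer k I g x \<le> (0, sum (pos_cost I) (\<Union>i<k. set (p i)))"
  using assms
proof (induction g arbitrary: x p)
  case 0
  then have e: "p i = []" if "i < k" for i using that by force
  have "x = index_of n k (\<lambda>_. target I)"
  proof (rule digits_eqI[OF 0(2)])
    show "index_of n k (\<lambda>_. target I) < n ^ k"
      using target_less by (intro index_of_less)
    show "digit n i x = digit n i (index_of n k (\<lambda>_. target I))" if "i < k" for i
      using 0(3)[OF that] e[OF that] target_less that by (simp add: digit_index_of awalk_Nil_iff)
  qed
  then show ?case using e by simp
next
  case (Suc g)
  let ?a = "sorted_arcs I ! g"
  let ?al = "\<lambda>i. ?a \<in> colour_class I (Suc i)"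
  have a: "?a < m" using Suc.prems sorted_arcs_less by simp
  \<comment> \<open>The first arc \<open>b\<close> of the walk has a tail no higher than that of
    \<open>?a\<close>, and all later tails are strictly lower than that of \<open>b\<close>. So
    \<open>?a\<close> can only be \<open>b\<close> itself.\<close>
  have split: "\<exists>q. p i = ?a # q \<and> ?a \<notin> set q" if "i < k" "?a \<in> set (p i)" for i
  proof -
    obtain b q where q: "p i = b # q" using \<open>?a \<in> set (p i)\<close> by (cases "p i") auto
    have w: "awalk (head G b) q (target I)" "b < m"
      using Suc.prems(3)[OF \<open>i < k\<close>] in_arcs by (auto simp: q awalk_Cons_iff)
    have le: "height I (tail G b) \<le> height I (tail G ?a)"
      using Suc.prems(4)[OF \<open>i < k\<close>] Suc.prems(1) height_sorted_arcs[of _ g] by (auto simp: q)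
    have "?a \<notin> set q"
      using height_along_walk[OF w(1), of ?a] height_arc[OF w(2)] le by auto
    with q \<open>?a \<in> set (p i)\<close> show ?thesis by auto
  qed
  define q where "q i = (if ?a \<in> set (p i) then tl (p i) else p i)" for i
  have q_sub: "set (q i) \<subseteq> (!) (sorted_arcs I) ` {..<g} \<inter> colour_class I (Suc i)" if "i < k" for i
  proof -
    have "set (q i) \<subseteq> set (p i)" by (auto simp: q_def dest: list.set_sel(2)[rotated])
    moreover have "?a \<notin> set (q i)" using split[OF that] by (auto simp: q_def)
    ultimately show ?thesis using Suc.prems(4)[OF that] unfolding lessThan_Suc by blast
  qed
  define y where "y = index_of n k (\<lambda>i. if ?a \<in> set (p i) then head G ?a else digit n i x)"
  have n: "0 < n" using source_less by simp
  have y_less: "y < n ^ k"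
    unfolding y_def using head_less[OF a] digit_less[OF n] by (intro index_of_less) auto
  have y_digit: "digit n i y = (if ?a \<in> set (p i) then head G ?a else digit n i x)" if "i < k" for i
    unfolding y_def using head_less[OF a] digit_less[OF n] that by (subst digit_index_of) auto
  have q_walk: "awalk (digit n i y) (q i) (target I)" if "i < k" for i
    using Suc.prems(3)[OF that] split[OF that] y_digit[OF that]
    by (auto simp: q_def awalk_Cons_iff)
  have reach: "reaches n ?al (tail G ?a) (head G ?a) i x y" if "i < k" for i
    using Suc.prems(3,4)[OF that] split[OF that] y_digit[OF that]
    by (auto simp: reaches_def awalk_Cons_iff)
  have IH: "layer k I g y \<le> (0, sum (pos_cost I) (\<Union>i<k. set (q i)))"
    using Suc.prems(1) y_less q_walk q_sub by (intro Suc.IH) auto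
  show ?case
  proof (cases "\<exists>i<k. ?a \<in> set (p i)")
    case True
    have "layer k I g (candidate k I ?a (layer k I g) k x) \<le> layer k I g y"
      unfolding candidate_def
      using Suc.prems(2) y_less head_less[OF a] reach by (intro best_le) auto
    with IH have "layer k I g (candidate k I ?a (layer k I g) k x) \<le>
      (0, sum (pos_cost I) (\<Union>i<k. set (q i)))" by (rule order_trans[rotated])
    then have *: "add_cost (pos_cost I ?a) (layer k I g (candidate k I ?a (layer k I g) k x)) \<le>
      (0, sum (pos_cost I) (\<Union>i<k. set (q i)) + pos_cost I ?a)"
      by (auto simp: add_cost_def less_eq_prod_def)
    \<comment> \<open>\<open>?a\<close> lies in some \<open>p i\<close> but in no
      \<open>q i\<close>, so passing to the shortened walks saves its cost exactly once.\<close>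
    have "(\<Union>i<k. set (p i)) = insert ?a (\<Union>i<k. set (q i))"
    proof -
      have "set (p i) = (if ?a \<in> set (p i) then insert ?a (set (q i)) else set (q i))"
        if "i < k" for i
        using split[OF that] by (cases "?a \<in> set (p i)") (auto simp: q_def)
      then have *: "set (q i) \<subseteq> set (p i)" "set (p i) \<subseteq> insert ?a (set (q i))" if "i < k" for i
        using that by (metis subset_insertI subset_refl)+
      obtain j where "j < k" "?a \<in> set (p j)" using True by blast
      with * show ?thesis by blast
    qed
    moreover have "?a \<notin> (\<Union>i<k. set (q i))"
      using q_sub sorted_arcs_notin[of g] Suc.prems(1) by auto
    ultimately have "sum (pos_cost I) (\<Union>i<k. set (p i)) =
      sum (pos_cost I) (\<Union>i<k. set (q i)) + pos_cost I ?a" by simp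
    with * show ?thesis
      unfolding layer_successor[OF Suc.prems(2), of g] by (intro min.coboundedI2) simp
  next
    case False
    have "y = x"
      by (rule digits_eqI[OF y_less Suc.prems(2)]) (use False y_digit in auto)
    moreover have "(\<Union>i<k. set (q i)) = (\<Union>i<k. set (p i))"
      using False by (auto simp: q_def)
    ultimately show ?thesis
      using IH unfolding layer_successor[OF Suc.prems(2), of g] by (intro min.coboundedI1) simp
  qed
qed

section \<open>From the layers to an optimal arc set\<close>

lemma sum_cost_split:
  assumes "A \<subseteq> arcs G"
  shows "sum (cost I) A = sum (cost I) {a \<in> A. cost I a < 0} + sum (pos_cost I) A"
proof -
  have fin: "finite A" using assms finite_arcs by (rule finite_subset)
  have "sum (cost I) A = (\<Sum>a\<in>A. (if cost I a < 0 then cost I a else 0) + pos_cost I a)"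
    by (intro sum.cong) (auto simp: pos_cost_def)
  then show ?thesis using fin by (simp add: sum.distrib sum.If_cases Int_def)
qed

abbreviation "start \<equiv> index_of n k (\<lambda>_. source I)"
abbreviation "answer \<equiv> solution k I m start \<union> {a. a < m \<and> cost I a < 0}"

lemma start_less: "start < n ^ k"
  using source_less by (intro index_of_less) simp

lemma layer_start_le:
  assumes "feasible k I B"
  shows "\<exists>C\<subseteq>B. layer k I m start \<le> (0, sum (pos_cost I) C)"
proof -
  have "\<forall>i\<in>{1..k}. \<exists>p. apath (source I) p (target I) \<and> set p \<subseteq> B \<inter> colour_class I i"
    using assms by (simp add: feasible_def)
  then obtain p where p: "\<And>i. i \<in> {1..k} \<Longrightarrow>
      apath (source I) (p i) (target I) \<and> set (p i) \<subseteq> B \<inter> colour_class I i"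
    by metis
  have p': "awalk (source I) (p (Suc i)) (target I)"
    "set (p (Suc i)) \<subseteq> B \<inter> colour_class I (Suc i)" if "i < k" for i
    using p[of "Suc i"] that by (auto simp: apath_def)
  have "layer k I m start \<le> (0, sum (pos_cost I) (\<Union>i<k. set (p (Suc i))))"
  proof (rule layer_optimal[OF order_refl start_less])
    fix i assume i: "i < k"
    show "awalk (digit n i start) (p (Suc i)) (target I)"
      using p'[OF i] i source_less by (simp add: digit_index_of)
    have "set (p (Suc i)) \<subseteq> {..<m}" using p'(1)[OF i] in_arcs by auto
    also have "\<dots> = (!) (sorted_arcs I) ` {..<m}"
      using set_sorted_arcs length_sorted_arcs set_conv_nth[of "sorted_arcs I"] by auto
    finally show "set (p (Suc i)) \<subseteq> (!) (sorted_arcs I) ` {..<m} \<inter> colour_class I (Suc i)"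
      using p'(2)[OF i] by auto
  qed
  with p'(2) show ?thesis by (intro exI[of _ "\<Union>i<k. set (p (Suc i))"]) auto
qed

lemma answer_subset: "answer \<subseteq> arcs G"
  using solution_subset[of m start] sorted_arcs_less in_arcs by auto

lemma answer_feasible:
  assumes "fst (layer k I m start) = 0"
  shows "feasible k I answer"
  unfolding feasible_def
proof (intro conjI ballI answer_subset)
  fix i assume "i \<in> {1..k}"
  then obtain j where j: "i = Suc j" "j < k" by (cases i) auto
  obtain p where p: "awalk (source I) p (target I)"
    "set p \<subseteq> solution k I m start \<inter> colour_class I i"
    using layer_feasible[OF order_refl start_less assms j(2)] j source_less
    by (auto simp: digit_index_of)
  \<comment> \<open>The layers provide walks; shortcutting one to a path only drops arcs, so its
    colour is kept.\<close>
  show "\<exists>p. apath (source I) p (target I) \<and> set p \<subseteq> answer \<inter> colour_class I i"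
    using apath_awalk_to_apath[OF p(1)] awalk_to_apath_subset[OF p(1)] p(2) by blast
qed

lemma answer_optimal:
  assumes "fst (layer k I m start) = 0"
  shows "optimal k I answer"
  unfolding optimal_def
proof (intro conjI allI impI answer_feasible assms)
  fix B assume B: "feasible k I B"
  then have BA: "B \<subseteq> arcs G" by (simp add: feasible_def)
  then have fin: "finite B" using finite_arcs by (rule finite_subset)
  obtain C where C: "C \<subseteq> B" "layer k I m start \<le> (0, sum (pos_cost I) C)"
    using layer_start_le[OF B] by blast
  have pos: "0 \<le> pos_cost I a" for a by (simp add: pos_cost_def)
  \<comment> \<open>The negative arcs have positive part 0, so adding them is free in this
    measure.\<close>
  have "sum (pos_cost I) answer = sum (pos_cost I) (solution k I m start)"
    by (rule sum.mono_neutral_right)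
      (use answer_subset finite_subset[OF _ finite_arcs] in \<open>auto simp: pos_cost_def\<close>)
  also have "\<dots> \<le> sum (pos_cost I) C"
    using C(2) assms layer_cost[OF order_refl, of start] by (auto simp: less_eq_prod_def)
  also have "\<dots> \<le> sum (pos_cost I) B"
    using C(1) fin pos by (intro sum_mono2) auto
  finally have 1: "sum (pos_cost I) answer \<le> sum (pos_cost I) B" .
  have "{a \<in> answer. cost I a < 0} = {a. a < m \<and> cost I a < 0}"
    using answer_subset in_arcs by auto
  moreover have "sum (cost I) {a. a < m \<and> cost I a < 0} \<le> sum (cost I) {a \<in> B. cost I a < 0}"
  proof -
    have sub: "{a \<in> B. cost I a < 0} \<subseteq> {a. a < m \<and> cost I a < 0}" using BA in_arcs by auto
    have "sum (cost I) ({a. a < m \<and> cost I a < 0} - {a \<in> B. cost I a < 0}) \<le> 0"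
      by (intro sum_nonpos) auto
    with sum.subset_diff[OF sub, of "cost I"] show ?thesis by simp
  qed
  ultimately show "sum (cost I) answer \<le> sum (cost I) B"
    using 1 sum_cost_split[OF BA] sum_cost_split[OF answer_subset] by simp
qed

text \<open>A feasible set bounds the value by a pair with first component 0, and the lexicographic
  order then forces the flag to be 0.\<close>

lemma feasible_iff: "(\<exists>B. feasible k I B) \<longleftrightarrow> fst (layer k I m start) = 0"
  using answer_feasible layer_start_le by (fastforce simp: less_eq_prod_def)

end

section \<open>Sorting the arcs and tabulating positions\<close>

text \<open>
  Scalars live in array 0 beyond the input: cells 4, 5, 10, 11 are loop counters (11 is the current
  state), 6 the number of arcs sorted so far, 7 the number n ^ k of states, 8 and 9 the states with
  all walkers at s and at t, 12, 16, 17 the current arc, its tail and its head, 13 and 14 the offsets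
  of the current and of the next layer, 15 a scratch cell. Behind the colour classes come the arrays
  k + 3 (heights), k + 4 (sorted arcs), k + 5 (best candidate per state), k + 6 and k + 7 (infeasibility
  flag and successor per layer and state), k + 8 + i (the multiples of n ^ i) and 2 k + 8 + i (the
  position of walker i). Real array 1 holds the positive parts of the costs, real array 2 the second
  component of the layers. Walkers are numbered from 0, so that walker i has colour i + 1.
\<close>

definition input_ok :: "nat \<Rightarrow> input \<Rightarrow> state \<Rightarrow> bool" where
  "input_ok k I \<sigma> \<longleftrightarrow> acyclic_instance k I \<and>
     sv \<sigma> 0 = nv I \<and> sv \<sigma> 1 = na I \<and> sv \<sigma> 2 = source I \<and> sv \<sigma> 3 = target I \<and>
     (\<forall>a<na I. nmem \<sigma> 1 a = tail (graph I) a \<and> nmem \<sigma> 2 a = head (graph I) a \<and>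
       rmem \<sigma> 0 a = cost I a \<and> (\<forall>i<k. nmem \<sigma> (i + 3) a = of_bool (a \<in> colour_class I (Suc i))))"

lemma input_ok_nstore [simp]:
  "(a = 0 \<longrightarrow> 4 \<le> j) \<Longrightarrow> a \<noteq> 1 \<Longrightarrow> a \<noteq> 2 \<Longrightarrow> a < 3 \<or> k + 3 \<le> a \<Longrightarrow>
    input_ok k I (nstore a j x \<sigma>) \<longleftrightarrow> input_ok k I \<sigma>"
proof -
  assume a: "a = 0 \<longrightarrow> 4 \<le> j" "a \<noteq> 1" "a \<noteq> 2" "a < 3 \<or> k + 3 \<le> a"
  have *: "i < k \<Longrightarrow> nmem (nstore a j x \<sigma>) (i + 3) b = nmem \<sigma> (i + 3) b" for i b
    using a(4) by simp linarith
  have "c < 4 \<Longrightarrow> sv (nstore a j x \<sigma>) c = sv \<sigma> c" for c using a(1) by auto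
  from this[of 0] this[of 1] this[of 2] this[of 3] * a(2,3) show ?thesis
    unfolding input_ok_def by (simp del: nmem_nstore) simp
qed

lemma input_ok_rstore [simp]: "a \<noteq> 0 \<Longrightarrow> input_ok k I (rstore a j x \<sigma>) \<longleftrightarrow> input_ok k I \<sigma>"
  by (simp add: input_ok_def)

section \<open>Heights by relaxation\<close>

definition heights_ok :: "nat \<Rightarrow> input \<Rightarrow> state \<Rightarrow> bool" where
  "heights_ok k I \<sigma> \<longleftrightarrow> (\<forall>v<nv I. nmem \<sigma> (k + 3) v = height I v)"

lemma heights_ok_nstore [simp]:
  "a \<noteq> k + 3 \<Longrightarrow> heights_ok k I (nstore a j x \<sigma>) \<longleftrightarrow> heights_ok k I \<sigma>"
  by (simp add: heights_ok_def)

text \<open>A Bellman-Ford iteration for longest walks, starting from zeros; \<open>n\<close> rounds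
  suffice because heights are below \<open>n\<close>.\<close>

definition relax_heights :: "nat \<Rightarrow> com" where
  "relax_heights k = For 4 (V 0) (For 5 (V 1)
     (Cond (NLess (NAt (k + 3) (NAt 1 (V 5))) (NAdd (NAt (k + 3) (NAt 2 (V 5))) (Num 1)))
       (NStore (k + 3) (NAt 1 (V 5)) (NAdd (NAt (k + 3) (NAt 2 (V 5))) (Num 1)))
       Skip))"

text \<open>The entries after \<open>r\<close> rounds are not determined exactly: a value updated
  early in a round may already be used later in it. Hence two bounds instead of an equation.\<close>

definition height_bounds :: "nat \<Rightarrow> nat \<Rightarrow> input \<Rightarrow> state \<Rightarrow> bool" where
  "height_bounds k r I \<sigma> \<longleftrightarrow>
     (\<forall>v<nv I. min r (height I v) \<le> nmem \<sigma> (k + 3) v \<and> nmem \<sigma> (k + 3) v \<le> height I v)"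

lemma height_bounds_nstore [simp]:
  "a \<noteq> k + 3 \<Longrightarrow> height_bounds k r I (nstore a j x \<sigma>) \<longleftrightarrow> height_bounds k r I \<sigma>"
  by (simp add: height_bounds_def)

text \<open>A positive height is realized through an arc, whose relaxation lifts the bound at its
  head by one; height 0 is trivial.\<close>

lemma height_bounds_Suc:
  assumes "input_ok k I \<sigma>" "height_bounds k r I \<sigma>"
    and "\<forall>a<na I. Suc (min r (height I (head (graph I) a))) \<le> nmem \<sigma> (k + 3) (tail (graph I) a)"
  shows "height_bounds k (Suc r) I \<sigma>"
  unfolding height_bounds_def
proof (intro allI impI conjI)
  interpret acyclic_instance k I using assms(1) by (simp add: input_ok_def)
  fix v assume v: "v < n"
  show "nmem \<sigma> (k + 3) v \<le> height I v" using assms(2) v by (simp add: height_bounds_def)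
  show "min (Suc r) (height I v) \<le> nmem \<sigma> (k + 3) v"
  proof (cases "height I v")
    case (Suc h)
    then obtain a where "a < m" "tail G a = v" "height I (head G a) = h"
      using height_attained[OF v] by blast
    with assms(3) Suc show ?thesis by force
  qed simp
qed

text \<open>Entries only grow, so the gains from earlier arcs persist; \<open>height_arc\<close>
  keeps the new entry below the true height.\<close>

lemma relax_step:
  fixes k I \<sigma>
  defines "a \<equiv> sv \<sigma> 5"
  defines "h \<equiv> nmem \<sigma> (k + 3) (head (graph I) a)" and "u \<equiv> tail (graph I) a"
  defines "\<tau> \<equiv> (if nmem \<sigma> (k + 3) u < Suc h then nstore (k + 3) u (Suc h) \<sigma> else \<sigma>)"
  assumes "input_ok k I \<sigma>" "height_bounds k r I \<sigma>" "a < na I"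
    and "\<forall>b<a. Suc (min r (height I (head (graph I) b))) \<le> nmem \<sigma> (k + 3) (tail (graph I) b)"
  shows "height_bounds k r I \<tau> \<and>
    (\<forall>b<Suc a. Suc (min r (height I (head (graph I) b))) \<le> nmem \<tau> (k + 3) (tail (graph I) b))"
proof -
  interpret acyclic_instance k I using assms(5) by (simp add: input_ok_def)
  have "Suc (height I (head G a)) \<le> height I u" "head G a < n" "u < n"
    using height_arc head_less tail_less assms(7) by (auto simp: u_def)
  moreover have "min r (height I (head G a)) \<le> h" "h \<le> height I (head G a)"
    using assms(6) \<open>head G a < n\<close> by (auto simp: height_bounds_def h_def)
  ultimately show ?thesis
    using assms(6,8) unfolding height_bounds_def \<tau>_def u_def less_Suc_eq
    by (auto split: if_splits)
qed

lemma input_size_bounds [simp]: "nv I \<le> input_size I" "na I \<le> input_size I"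
  by (simp_all add: input_size_def)

lemma tri_relax_heights:
  "tri input_size (\<lambda>I \<sigma>. input_ok k I \<sigma> \<and> (\<forall>v. nmem \<sigma> (k + 3) v = 0)) (relax_heights k)
    (\<lambda>I \<sigma>. input_ok k I \<sigma> \<and> heights_ok k I \<sigma>)"
  unfolding relax_heights_def
proof (rule tri_For[where R = "input_ok k" and N = nv and q = "[:0, 1:]"
    and Inv = "\<lambda>I \<sigma>. height_bounds k (sv \<sigma> 4) I \<sigma>"], goal_cases)
  case 1
  show ?case
  proof (rule tri_For[where R = "input_ok k" and N = na and q = "[:0, 1:]"
    and Inv = "\<lambda>I \<sigma>. height_bounds k (sv \<sigma> 4) I \<sigma> \<and>
      (\<forall>b<sv \<sigma> 5. Suc (min (sv \<sigma> 4) (height I (head (graph I) b))) \<le> nmem \<sigma> (k + 3) (tail (graph I) b))"],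
    goal_cases)
    case 1
    show ?case
    proof (rule tri_exec, goal_cases)
      case (2 I \<sigma>)
      then show ?case using relax_step[of k I \<sigma> "sv \<sigma> 4"] by (auto simp: input_ok_def split: if_splits)
    qed simp
  next
    case (9 I \<sigma>)
    then show ?case using height_bounds_Suc[of k I \<sigma> "sv \<sigma> 4"] by (simp add: input_ok_def)
  qed (simp_all add: input_ok_def)
next
  case (6 I \<sigma>)
  then show ?case by simp
next
  case (9 I \<sigma>)
  then interpret acyclic_instance k I by (simp add: input_ok_def)
  \<comment> \<open>After \<open>n\<close> rounds the lower bound \<open>min n (height I v)\<close>
    is the height itself.\<close>
  have "nmem \<sigma> (k + 3) v = height I v" if v: "v < n" for v
    using 9 v height_less[OF v] by (auto simp: height_bounds_def)
  with 9 show ?case by (simp add: heights_ok_def)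
qed (simp_all add: height_bounds_def, simp_all add: input_ok_def)

section \<open>Bucket sort of the arcs\<close>

definition order_ok :: "nat \<Rightarrow> input \<Rightarrow> state \<Rightarrow> bool" where
  "order_ok k I \<sigma> \<longleftrightarrow> (\<forall>g<na I. nmem \<sigma> (k + 4) g = sorted_arcs I ! g)"

lemma order_ok_nstore [simp]:
  "a \<noteq> k + 4 \<Longrightarrow> order_ok k I (nstore a j x \<sigma>) \<longleftrightarrow> order_ok k I \<sigma>"
  by (simp add: order_ok_def)

lemma order_ok_rstore [simp]: "order_ok k I (rstore a j x \<sigma>) \<longleftrightarrow> order_ok k I \<sigma>"
  by (simp add: order_ok_def)

text \<open>One scan over all arcs per height; this takes \<open>n * m\<close> rounds and yields
  literally the list \<open>arcs_below\<close>.\<close>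

definition sort_arcs :: "nat \<Rightarrow> com" where
  "sort_arcs k = Seq (NStore 0 (Num 6) (Num 0)) (For 4 (V 0) (For 5 (V 1)
     (Cond (eq_test (NAt (k + 3) (NAt 1 (V 5))) (V 4))
       (Seq (NStore (k + 4) (V 6) (V 5)) (NStore 0 (Num 6) (NAdd (V 6) (Num 1))))
       Skip)))"

definition holds_list :: "nat \<Rightarrow> nat list \<Rightarrow> state \<Rightarrow> bool" where
  "holds_list k xs \<sigma> \<longleftrightarrow> sv \<sigma> 6 = length xs \<and> (\<forall>i<length xs. nmem \<sigma> (k + 4) i = xs ! i)"

lemma holds_list_nstore [simp]:
  "a \<noteq> k + 4 \<Longrightarrow> a = 0 \<longrightarrow> j \<noteq> 6 \<Longrightarrow> holds_list k xs (nstore a j x \<sigma>) \<longleftrightarrow> holds_list k xs \<sigma>"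
  by (auto simp: holds_list_def)

lemma holds_list_snoc:
  "holds_list k xs \<sigma> \<Longrightarrow>
    holds_list k (xs @ [y]) (nstore 0 6 (Suc (length xs)) (nstore (k + 4) (length xs) y \<sigma>))"
  by (auto simp: holds_list_def nth_append)

lemma arcs_at_height_0 [simp]: "arcs_at_height I h 0 = []"
  by (simp add: arcs_at_height_def)

lemma arcs_at_height_Suc:
  "arcs_at_height I h (Suc j) =
    arcs_at_height I h j @ (if height I (tail (graph I) j) = h then [j] else [])"
  by (simp add: arcs_at_height_def)

lemma arcs_below_0 [simp]: "arcs_below I 0 = []"
  by (simp add: arcs_below_def)

lemma input_ok_tail: "input_ok k I \<sigma> \<Longrightarrow> a < na I \<Longrightarrow> nmem \<sigma> (Suc 0) a = tail (graph I) a"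
  and input_ok_head: "input_ok k I \<sigma> \<Longrightarrow> a < na I \<Longrightarrow> nmem \<sigma> 2 a = head (graph I) a"
  and input_ok_cost: "input_ok k I \<sigma> \<Longrightarrow> a < na I \<Longrightarrow> rmem \<sigma> 0 a = cost I a"
  by (simp_all add: input_ok_def)

lemma input_ok_scalars:
  "input_ok k I \<sigma> \<Longrightarrow> sv \<sigma> 0 = nv I" "input_ok k I \<sigma> \<Longrightarrow> sv \<sigma> (Suc 0) = na I"
  "input_ok k I \<sigma> \<Longrightarrow> sv \<sigma> 2 = source I" "input_ok k I \<sigma> \<Longrightarrow> sv \<sigma> 3 = target I"
  by (simp_all add: input_ok_def)

lemma tri_sort_arcs:
  "tri input_size (\<lambda>I \<sigma>. input_ok k I \<sigma> \<and> heights_ok k I \<sigma>) (sort_arcs k)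
    (\<lambda>I \<sigma>. input_ok k I \<sigma> \<and> order_ok k I \<sigma>)"
  unfolding sort_arcs_def
proof (rule tri_Seq[where B = "\<lambda>I \<sigma>. (input_ok k I \<sigma> \<and> heights_ok k I \<sigma>) \<and> sv \<sigma> 6 = 0"], goal_cases)
  case 1
  show ?case by (rule tri_exec) simp_all
next
  let ?R = "\<lambda>I \<sigma>. input_ok k I \<sigma> \<and> heights_ok k I \<sigma>"
  case 2
  show ?case
  proof (rule tri_For[where R = ?R and N = nv and q = "[:0, 1:]"
    and Inv = "\<lambda>I \<sigma>. holds_list k (arcs_below I (sv \<sigma> 4)) \<sigma>"], goal_cases)
    case 1
    show ?case
    proof (rule tri_For[where R = ?R and N = na and q = "[:0, 1:]"
      and Inv = "\<lambda>I \<sigma>. holds_list k (arcs_below I (sv \<sigma> 4) @ arcs_at_height I (sv \<sigma> 4) (sv \<sigma> 5)) \<sigma>"],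
      goal_cases)
      case 1
      show ?case
      proof (rule tri_exec, goal_cases)
        case (2 I \<sigma>)
        then interpret acyclic_instance k I by (simp add: input_ok_def)
        have "sv \<sigma> 6 = length (arcs_below I (sv \<sigma> 4) @ arcs_at_height I (sv \<sigma> 4) (sv \<sigma> 5))"
          using 2 by (simp add: holds_list_def)
        moreover have "nmem \<sigma> (k + 3) (nmem \<sigma> 1 (sv \<sigma> 5)) = height I (tail G (sv \<sigma> 5))"
          using 2 tail_less by (auto simp: input_ok_tail heights_ok_def)
        ultimately show ?case
          using 2 holds_list_snoc[of k "arcs_below I (sv \<sigma> 4) @ arcs_at_height I (sv \<sigma> 4) (sv \<sigma> 5)" \<sigma> "sv \<sigma> 5"]
          by (auto simp: arcs_at_height_Suc)
      qed simp
    next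
      case (9 I \<sigma>)
      then show ?case by (simp add: arcs_below_Suc)
    qed (auto intro: input_ok_scalars)
  next
    case (9 I \<sigma>)
    then interpret acyclic_instance k I by (simp add: input_ok_def)
    from 9 length_sorted_arcs show ?case by (simp add: holds_list_def order_ok_def)
  qed (auto simp: holds_list_def intro: input_ok_scalars)
qed

section \<open>Positive costs, powers of \<open>n\<close> and digits\<close>

definition costs_ok :: "input \<Rightarrow> state \<Rightarrow> bool" where
  "costs_ok I \<sigma> \<longleftrightarrow> (\<forall>a<na I. rmem \<sigma> 1 a = pos_cost I a)"

lemma costs_ok_nstore [simp]: "costs_ok I (nstore a j x \<sigma>) \<longleftrightarrow> costs_ok I \<sigma>"
  by (simp add: costs_ok_def)

lemma costs_ok_rstore [simp]: "a \<noteq> 1 \<Longrightarrow> costs_ok I (rstore a j x \<sigma>) \<longleftrightarrow> costs_ok I \<sigma>"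
  by (simp add: costs_ok_def)

definition set_costs :: com where
  "set_costs = For 5 (V 1) (Cond (RLess (RAt 0 (V 5)) RZero)
     (RStore 1 (V 5) RZero) (RStore 1 (V 5) (RAt 0 (V 5))))"

lemma tri_set_costs:
  "tri input_size (\<lambda>I \<sigma>. input_ok k I \<sigma> \<and> order_ok k I \<sigma>) set_costs
    (\<lambda>I \<sigma>. input_ok k I \<sigma> \<and> order_ok k I \<sigma> \<and> costs_ok I \<sigma>)"
  unfolding set_costs_def
proof (rule tri_For[where R = "\<lambda>I \<sigma>. input_ok k I \<sigma> \<and> order_ok k I \<sigma>" and N = na and q = "[:0, 1:]"
    and Inv = "\<lambda>I \<sigma>. \<forall>a<sv \<sigma> 5. rmem \<sigma> 1 a = pos_cost I a"], goal_cases)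
  case 1
  show ?case
    by (rule tri_exec) (auto simp: input_ok_cost pos_cost_def less_Suc_eq)
qed (auto simp: costs_ok_def intro: input_ok_scalars)

text \<open>The range of \<open>v\<close> includes \<open>n\<close>, since \<open>n * n ^ j\<close>
  is the next power, which \<open>set_powers\<close> copies into cell 7.\<close>

definition powers_ok :: "nat \<Rightarrow> nat \<Rightarrow> input \<Rightarrow> state \<Rightarrow> bool" where
  "powers_ok k i I \<sigma> \<longleftrightarrow> sv \<sigma> 7 = nv I ^ i \<and> sv \<sigma> 8 = index_of (nv I) i (\<lambda>_. source I) \<and>
     sv \<sigma> 9 = index_of (nv I) i (\<lambda>_. target I) \<and>
     (\<forall>j<i. \<forall>v\<le>nv I. nmem \<sigma> (k + 8 + j) v = v * nv I ^ j)"

lemma powers_ok_nstore [simp]: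
  "(a = 0 \<longrightarrow> j \<noteq> 7 \<and> j \<noteq> 8 \<and> j \<noteq> 9) \<Longrightarrow> a < k + 8 \<or> k + 8 + i \<le> a \<Longrightarrow>
    powers_ok k i I (nstore a j x \<sigma>) \<longleftrightarrow> powers_ok k i I \<sigma>"
proof -
  assume a: "a = 0 \<longrightarrow> j \<noteq> 7 \<and> j \<noteq> 8 \<and> j \<noteq> 9" "a < k + 8 \<or> k + 8 + i \<le> a"
  have "h < i \<Longrightarrow> nmem (nstore a j x \<sigma>) (k + 8 + h) v = nmem \<sigma> (k + 8 + h) v" for h v
    using a(2) by simp linarith
  with a(1) show ?thesis unfolding powers_ok_def by auto
qed

lemma powers_ok_rstore [simp]: "powers_ok k i I (rstore a j x \<sigma>) \<longleftrightarrow> powers_ok k i I \<sigma>"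
  by (simp add: powers_ok_def)

definition set_powers :: "nat \<Rightarrow> com" where
  "set_powers k = Seq (Seq (NStore 0 (Num 7) (Num 1)) (Seq (NStore 0 (Num 8) (Num 0)) (NStore 0 (Num 9) (Num 0))))
     (unroll (\<lambda>i. Seq (NStore (k + 8 + i) (Num 0) (Num 0))
       (Seq (For 5 (V 0) (NStore (k + 8 + i) (NAdd (V 5) (Num 1)) (NAdd (NAt (k + 8 + i) (V 5)) (V 7))))
         (Seq (NStore 0 (Num 8) (NAdd (V 8) (NAt (k + 8 + i) (V 2))))
         (Seq (NStore 0 (Num 9) (NAdd (V 9) (NAt (k + 8 + i) (V 3))))
           (NStore 0 (Num 7) (NAt (k + 8 + i) (V 0))))))) k)"

lemma tri_set_powers:
  "tri input_size (\<lambda>I \<sigma>. input_ok k I \<sigma> \<and> order_ok k I \<sigma> \<and> costs_ok I \<sigma>) (set_powers k)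
    (\<lambda>I \<sigma>. powers_ok k k I \<sigma> \<and> input_ok k I \<sigma> \<and> order_ok k I \<sigma> \<and> costs_ok I \<sigma>)"
  unfolding set_powers_def
proof (rule tri_Seq[where B = "\<lambda>I \<sigma>. powers_ok k 0 I \<sigma> \<and>
    input_ok k I \<sigma> \<and> order_ok k I \<sigma> \<and> costs_ok I \<sigma>"], goal_cases)
  case 1
  show ?case by (rule tri_exec) (simp_all, simp add: powers_ok_def index_of_def)
next
  let ?R = "\<lambda>I \<sigma>. input_ok k I \<sigma> \<and> order_ok k I \<sigma> \<and> costs_ok I \<sigma>"
  case 2
  show ?case
  proof (rule tri_unroll[where Inv = "powers_ok k" and R = ?R], goal_cases)
    case (1 i)
    let ?A = "\<lambda>I \<sigma>. powers_ok k i I \<sigma> \<and> ?R I \<sigma>"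
    let ?B = "\<lambda>I \<sigma>. ?A I \<sigma> \<and> (\<forall>v\<le>nv I. nmem \<sigma> (k + 8 + i) v = v * nv I ^ i)"
    show ?case
    proof (rule tri_Seq[where B = "\<lambda>I \<sigma>. ?A I \<sigma> \<and> nmem \<sigma> (k + 8 + i) 0 = 0"], goal_cases)
      case 1
      show ?case by (rule tri_exec) simp_all
    next
      case 2
      show ?case
      proof (rule tri_Seq[where B = ?B], goal_cases)
        case 1
        show ?case
        proof (rule tri_For[where R = ?A and N = nv and q = "[:0, 1:]"
          and Inv = "\<lambda>I \<sigma>. \<forall>v\<le>sv \<sigma> 5. nmem \<sigma> (k + 8 + i) v = v * nv I ^ i"], goal_cases)
          case 1
          show ?case
            by (rule tri_exec) (auto simp: powers_ok_def le_Suc_eq)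
        qed (auto intro: input_ok_scalars)
      next
        case 2
        show ?case
        proof (rule tri_exec, goal_cases)
          case (2 I \<sigma>)
          then interpret acyclic_instance k I by (simp add: input_ok_def)
          have "sv \<sigma> 0 = n" "sv \<sigma> 2 = source I" "sv \<sigma> 3 = target I"
            using 2 by (simp_all add: input_ok_def)
          then show ?case using 2 source_less target_less
            by (simp add: powers_ok_def index_of_def less_Suc_eq all_conj_distrib)
        qed simp
      qed
    qed
  qed simp_all
qed

definition digits_ok :: "nat \<Rightarrow> nat \<Rightarrow> input \<Rightarrow> state \<Rightarrow> bool" where
  "digits_ok k i I \<sigma> \<longleftrightarrow> (\<forall>j<i. \<forall>x<nv I ^ k. nmem \<sigma> (2 * k + 8 + j) x = digit (nv I) j x)"

lemma digits_ok_nstore [simp]: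
  "a < 2 * k + 8 \<or> 2 * k + 8 + i \<le> a \<Longrightarrow>
    digits_ok k i I (nstore a j x \<sigma>) \<longleftrightarrow> digits_ok k i I \<sigma>"
  unfolding digits_ok_def by (intro all_cong1 imp_cong refl) (simp, linarith)

lemma digits_ok_rstore [simp]: "digits_ok k i I (rstore a j x \<sigma>) \<longleftrightarrow> digits_ok k i I \<sigma>"
  by (simp add: digits_ok_def)

definition set_digits :: "nat \<Rightarrow> com" where
  "set_digits k = unroll (\<lambda>i. For 11 (V 7)
     (Cond (NLess (V 11) (NAt (k + 8 + i) (Num 1)))
       (NStore (2 * k + 8 + i) (V 11) (Num 0))
       (Cond (NLess (NAdd (NAt (2 * k + 8 + i) (NSub (V 11) (NAt (k + 8 + i) (Num 1)))) (Num 1)) (V 0))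
         (NStore (2 * k + 8 + i) (V 11) (NAdd (NAt (2 * k + 8 + i) (NSub (V 11) (NAt (k + 8 + i) (Num 1)))) (Num 1)))
         (NStore (2 * k + 8 + i) (V 11) (Num 0))))) k"

text \<open>Subtracting \<open>n ^ i\<close> lowers the quotient by one, so digits advance
  cyclically along steps of length \<open>n ^ i\<close>. This recursion replaces division.\<close>

lemma digit_step:
  assumes "0 < n"
  shows "digit n i x = (if x < n ^ i then 0
    else if Suc (digit n i (x - n ^ i)) < n then Suc (digit n i (x - n ^ i)) else 0)"
proof (cases "x < n ^ i")
  case False
  then obtain y where y: "x = n ^ i + y" using le_iff_add by (metis not_less)
  have "digit n i x = Suc (y div n ^ i) mod n"
    using assms y by (simp add: digit_def)
  moreover have "Suc (y div n ^ i mod n) \<le> n" using assms by (simp add: Suc_leI)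
  ultimately show ?thesis using y False assms by (auto simp: digit_def mod_Suc)
qed (simp add: digit_def)

abbreviation tables_ok :: "nat \<Rightarrow> input \<Rightarrow> state \<Rightarrow> bool" where
  "tables_ok k I \<sigma> \<equiv> powers_ok k k I \<sigma> \<and> input_ok k I \<sigma> \<and> order_ok k I \<sigma> \<and> costs_ok I \<sigma>"

text \<open>Here the constancy of \<open>k\<close> makes the number of rounds of all loops over
  states polynomial.\<close>

lemma states_le: "nv I ^ k \<le> poly ([:0, 1:] ^ k) (input_size I)"
  by (simp add: poly_power power_mono)

lemma tri_set_digits:
  "tri input_size (tables_ok k) (set_digits k) (\<lambda>I \<sigma>. digits_ok k k I \<sigma> \<and> tables_ok k I \<sigma>)"
  unfolding set_digits_def
proof (rule tri_unroll[where Inv = "digits_ok k" and R = "tables_ok k"], goal_cases)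
  case (1 i)
  let ?R = "\<lambda>I \<sigma>. digits_ok k i I \<sigma> \<and> tables_ok k I \<sigma>"
  show ?case
  proof (rule tri_For[where R = ?R and N = "\<lambda>I. nv I ^ k" and q = "[:0, 1:] ^ k"
      and Inv = "\<lambda>I \<sigma>. \<forall>x<sv \<sigma> 11. nmem \<sigma> (2 * k + 8 + i) x = digit (nv I) i x"], goal_cases)
    case 1
    show ?case
    proof (rule tri_exec, goal_cases)
      case (2 I \<sigma>)
      then interpret acyclic_instance k I by (simp add: input_ok_def)
      have n: "0 < n" using source_less by simp
      \<comment> \<open>The multiple for the factor 1 is the power itself.\<close>
      have p: "nmem \<sigma> (k + 8 + i) (Suc 0) = n ^ i"
        using 2 \<open>i < k\<close> n by (simp add: powers_ok_def)
      \<comment> \<open>The entry that is read has a strictly smaller index, so an earlier round has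
        filled it.\<close>
      have "0 < n ^ i" using n by simp
      then have "sv \<sigma> 11 - n ^ i < sv \<sigma> 11" if "\<not> sv \<sigma> 11 < n ^ i"
        using that by linarith
      then have "nmem \<sigma> (2 * k + 8 + i) (sv \<sigma> 11 - n ^ i) = digit n i (sv \<sigma> 11 - n ^ i)"
        if "\<not> sv \<sigma> 11 < n ^ i" using 2 that by blast
      then show ?case
        using 2 p digit_step[OF n, of i "sv \<sigma> 11"] by (auto simp: input_ok_scalars less_Suc_eq)
    qed simp
  next
    case (5 I \<sigma>)
    then show ?case by (simp add: powers_ok_def)
  next
    case (6 I \<sigma>)
    show ?case by (rule states_le)
  next
    case (9 I \<sigma>)
    then show ?case by (auto simp: digits_ok_def less_Suc_eq)
  qed (use 1 in \<open>simp_all\<close>)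
qed (simp_all add: digits_ok_def)

section \<open>Computing the layers\<close>

text \<open>Disjunction by De Morgan: once \<open>NLess e f\<close> fails, the negation of
  \<open>NLess f e\<close> says that the first components are equal.\<close>

definition lex_less :: "nexp \<Rightarrow> rexp \<Rightarrow> nexp \<Rightarrow> rexp \<Rightarrow> bexp" where
  "lex_less e r f s = BNot (BAnd (BNot (NLess e f)) (BNot (BAnd (BNot (NLess f e)) (RLess r s))))"

lemma bval_lex_less [simp]:
  "bval (lex_less e r f s) \<sigma> \<longleftrightarrow> (nval e \<sigma>, rval r \<sigma>) < (nval f \<sigma>, rval s \<sigma>)"
  by (auto simp: lex_less_def less_prod_def)

text \<open>Layer \<open>h\<close> fills the block that starts at \<open>h * n ^ k\<close>. The
  successors chosen at stage \<open>h\<close> are filed in block \<open>Suc h\<close>, the layer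
  that they define. All blocks are kept for tracing back.\<close>

definition layers_ok :: "nat \<Rightarrow> nat \<Rightarrow> input \<Rightarrow> state \<Rightarrow> bool" where
  "layers_ok k g I \<sigma> \<longleftrightarrow>
     (\<forall>h\<le>g. \<forall>x<nv I ^ k. nmem \<sigma> (k + 6) (h * nv I ^ k + x) = fst (layer k I h x) \<and>
        rmem \<sigma> 2 (h * nv I ^ k + x) = snd (layer k I h x)) \<and>
     (\<forall>h<g. \<forall>x<nv I ^ k. nmem \<sigma> (k + 7) (Suc h * nv I ^ k + x) =
        successor k I (sorted_arcs I ! h) (layer k I h) x)"

lemma layers_ok_nstore [simp]:
  "a \<noteq> k + 6 \<Longrightarrow> a \<noteq> k + 7 \<Longrightarrow> layers_ok k g I (nstore a j x \<sigma>) \<longleftrightarrow> layers_ok k g I \<sigma>"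
  by (simp add: layers_ok_def)

text \<open>Blocks do not overlap, so writing block \<open>Suc g\<close> leaves the blocks up to
  \<open>g\<close> intact.\<close>

lemma layer_index_less:
  assumes "h \<le> g" "x < (N::nat)" shows "h * N + x < Suc g * N"
proof -
  have "h * N + x < Suc h * N" using assms(2) by simp
  also have "\<dots> \<le> Suc g * N" using assms(1) by (intro mult_le_mono1) simp
  finally show ?thesis .
qed

lemma layers_ok_nstore_above:
  assumes "layers_ok k g I \<sigma>" "Suc g * nv I ^ k \<le> j"
  shows "layers_ok k g I (nstore a j x \<sigma>)"
proof -
  have "j \<noteq> h * nv I ^ k + y" if "h \<le> g" "y < nv I ^ k" for h y
    using layer_index_less[OF that] assms(2) by linarith
  then show ?thesis using assms(1) unfolding layers_ok_def
    by (simp del: mult_Suc)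
qed

lemma layers_ok_rstore_above:
  assumes "layers_ok k g I \<sigma>" "Suc g * nv I ^ k \<le> j"
  shows "layers_ok k g I (rstore a j x \<sigma>)"
proof -
  have "j \<noteq> h * nv I ^ k + y" if "h \<le> g" "y < nv I ^ k" for h y
    using layer_index_less[OF that] assms(2) by linarith
  then show ?thesis using assms(1) unfolding layers_ok_def by (simp del: mult_Suc)
qed

abbreviation setup_ok :: "nat \<Rightarrow> input \<Rightarrow> state \<Rightarrow> bool" where
  "setup_ok k I \<sigma> \<equiv> digits_ok k k I \<sigma> \<and> tables_ok k I \<sigma>"

definition bases_ok :: "nat \<Rightarrow> nat \<Rightarrow> input \<Rightarrow> state \<Rightarrow> bool" where
  "bases_ok k g I \<sigma> \<longleftrightarrow> layers_ok k g I \<sigma> \<and> sv \<sigma> 13 = g * nv I ^ k \<and> sv \<sigma> 14 = Suc g * nv I ^ k"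

lemma bases_ok_nstore [simp]:
  "a \<noteq> k + 6 \<Longrightarrow> a \<noteq> k + 7 \<Longrightarrow> a = 0 \<longrightarrow> j \<noteq> 13 \<and> j \<noteq> 14 \<Longrightarrow>
    bases_ok k g I (nstore a j x \<sigma>) \<longleftrightarrow> bases_ok k g I \<sigma>"
  by (auto simp: bases_ok_def)

definition init_layer :: "nat \<Rightarrow> com" where
  "init_layer k = Seq (For 11 (V 7) (Seq (NStore (k + 6) (V 11) (Num 1)) (RStore 2 (V 11) RZero)))
     (Seq (NStore (k + 6) (V 9) (Num 0)) (Seq (NStore 0 (Num 13) (Num 0)) (NStore 0 (Num 14) (V 7))))"

lemma powers_ok_states: "powers_ok k k I \<sigma> \<Longrightarrow> sv \<sigma> 7 = nv I ^ k"
  by (simp add: powers_ok_def)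

lemma tri_init_layer:
  "tri input_size (\<lambda>I \<sigma>. setup_ok k I \<sigma>) (init_layer k) (\<lambda>I \<sigma>. setup_ok k I \<sigma> \<and> bases_ok k 0 I \<sigma>)"
  unfolding init_layer_def
proof (rule tri_Seq[where B = "\<lambda>I \<sigma>. setup_ok k I \<sigma> \<and>
    (\<forall>x<nv I ^ k. nmem \<sigma> (k + 6) x = 1 \<and> rmem \<sigma> 2 x = 0)"], goal_cases)
  case 1
  show ?case
  proof (rule tri_For[where R = "setup_ok k" and N = "\<lambda>I. nv I ^ k" and q = "[:0, 1:] ^ k"
      and Inv = "\<lambda>I \<sigma>. \<forall>x<sv \<sigma> 11. nmem \<sigma> (k + 6) x = 1 \<and> rmem \<sigma> 2 x = 0"], goal_cases)
    case 1
    show ?case by (rule tri_exec) (auto simp: less_Suc_eq)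
  next
    case (6 I \<sigma>)
    show ?case by (rule states_le)
  qed (auto intro: powers_ok_states)
next
  case 2
  show ?case
    by (rule tri_exec) (simp_all, auto simp: bases_ok_def layers_ok_def powers_ok_def)
qed

section \<open>One stage of the dynamic program\<close>

definition stage_ok :: "nat \<Rightarrow> input \<Rightarrow> state \<Rightarrow> bool" where
  "stage_ok k I \<sigma> \<longleftrightarrow> setup_ok k I \<sigma> \<and> sv \<sigma> 10 < na I \<and> bases_ok k (sv \<sigma> 10) I \<sigma> \<and>
     sv \<sigma> 12 = sorted_arcs I ! sv \<sigma> 10 \<and>
     sv \<sigma> 16 = tail (graph I) (sv \<sigma> 12) \<and> sv \<sigma> 17 = head (graph I) (sv \<sigma> 12)"

lemma stage_ok_nstore [simp]:
  "a = 0 \<and> (j = 11 \<or> j = 15) \<or> a = k + 5 \<Longrightarrow> stage_ok k I (nstore a j x \<sigma>) \<longleftrightarrow> stage_ok k I \<sigma>"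
  by (auto simp: stage_ok_def)

text \<open>\<open>j\<close> is arbitrary because stability is checked in every state with
  \<open>stage_ok\<close>, whatever cell 11 holds; anything from the offset of the next layer on may
  be overwritten.\<close>

lemma stage_ok_store_above:
  assumes "stage_ok k I \<sigma>"
  shows "stage_ok k I (nstore (k + 6) (sv \<sigma> 14 + j) x \<sigma>)"
    and "stage_ok k I (nstore (k + 7) (sv \<sigma> 14 + j) x \<sigma>)"
    and "stage_ok k I (rstore 2 (sv \<sigma> 14 + j) y \<sigma>)"
  using assms layers_ok_nstore_above layers_ok_rstore_above
  by (auto simp: stage_ok_def bases_ok_def)

definition candidates_ok :: "nat \<Rightarrow> nat \<Rightarrow> input \<Rightarrow> state \<Rightarrow> bool" where
  "candidates_ok k i I \<sigma> \<longleftrightarrow> (\<forall>x<nv I ^ k. nmem \<sigma> (k + 5) x =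
     candidate k I (sorted_arcs I ! sv \<sigma> 10) (layer k I (sv \<sigma> 10)) i x)"

lemma candidates_ok_nstore [simp]:
  "a \<noteq> k + 5 \<Longrightarrow> a = 0 \<longrightarrow> j \<noteq> 10 \<Longrightarrow> candidates_ok k i I (nstore a j x \<sigma>) \<longleftrightarrow> candidates_ok k i I \<sigma>"
  by (auto simp: candidates_ok_def)

lemma candidates_ok_rstore [simp]: "candidates_ok k i I (rstore a j x \<sigma>) \<longleftrightarrow> candidates_ok k i I \<sigma>"
  by (simp add: candidates_ok_def)

definition improve :: "nat \<Rightarrow> nat \<Rightarrow> com" where
  "improve k i = Cond (BAnd (eq_test (NAt (2 * k + 8 + i) (V 11)) (V 16)) (NLess (Num 0) (NAt (i + 3) (V 12))))
     (Seq (NStore 0 (Num 15) (NSub (NAdd (V 11) (NAt (k + 8 + i) (V 17))) (NAt (k + 8 + i) (V 16))))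
       (Cond (lex_less (NAt (k + 6) (NAdd (V 13) (NAt (k + 5) (V 15)))) (RAt 2 (NAdd (V 13) (NAt (k + 5) (V 15))))
           (NAt (k + 6) (NAdd (V 13) (NAt (k + 5) (V 11)))) (RAt 2 (NAdd (V 13) (NAt (k + 5) (V 11)))))
         (NStore (k + 5) (V 11) (NAt (k + 5) (V 15)))
         Skip))
     Skip"

definition improve_colour :: "nat \<Rightarrow> nat \<Rightarrow> com" where
  "improve_colour k i = For 11 (V 7) (improve k i)"

lemma stage_ok_states: "stage_ok k I \<sigma> \<Longrightarrow> sv \<sigma> 7 = nv I ^ k"
  by (simp add: stage_ok_def powers_ok_def)

lemma stage_ok_layer:
  assumes "stage_ok k I \<sigma>" "x < nv I ^ k"
  shows "(nmem \<sigma> (k + 6) (sv \<sigma> 13 + x), rmem \<sigma> 2 (sv \<sigma> 13 + x)) = layer k I (sv \<sigma> 10) x"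
  using assms by (simp add: stage_ok_def bases_ok_def layers_ok_def)

lemma (in acyclic_instance) candidate_less:
  "x < n ^ k \<Longrightarrow> a < m \<Longrightarrow> i \<le> k \<Longrightarrow> candidate k I a val i x < n ^ k"
  using best_less_and_reaches[of x n k "head G a" i] head_less by (simp add: candidate_def)

text \<open>The candidates are updated in place. This is harmless: the entry read for x belongs to a state
  in which walker i is at the head of the arc, and such states are not changed in this round.\<close>

lemma improve_step:
  fixes k i I \<sigma>
  defines "a \<equiv> sorted_arcs I ! sv \<sigma> 10"
  defines "val \<equiv> layer k I (sv \<sigma> 10)"
  defines "x \<equiv> sv \<sigma> 11"
  defines "y \<equiv> x + nmem \<sigma> (k + 8 + i) (sv \<sigma> 17) - nmem \<sigma> (k + 8 + i) (sv \<sigma> 16)"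
  assumes st: "stage_ok k I \<sigma>" and i: "i < k" and x: "x < nv I ^ k"
    and P: "\<forall>z<nv I ^ k. nmem \<sigma> (k + 5) z = candidate k I a val (if z < x then Suc i else i) z"
  shows "nmem \<sigma> (2 * k + 8 + i) x = digit (nv I) i x"
    and "nmem \<sigma> (i + 3) (sv \<sigma> 12) = of_bool (a \<in> colour_class I (Suc i))"
    and "candidate k I a val (Suc i) x =
      (if digit (nv I) i x = sv \<sigma> 16 \<and> a \<in> colour_class I (Suc i) \<and>
        (nmem \<sigma> (k + 6) (sv \<sigma> 13 + nmem \<sigma> (k + 5) y), rmem \<sigma> 2 (sv \<sigma> 13 + nmem \<sigma> (k + 5) y)) <
        (nmem \<sigma> (k + 6) (sv \<sigma> 13 + nmem \<sigma> (k + 5) x), rmem \<sigma> 2 (sv \<sigma> 13 + nmem \<sigma> (k + 5) x))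
       then nmem \<sigma> (k + 5) y else nmem \<sigma> (k + 5) x)"
proof -
  interpret acyclic_instance k I using st by (simp add: stage_ok_def input_ok_def)
  have a: "a < m" using st sorted_arcs_less by (simp add: a_def stage_ok_def)
  have sv: "sv \<sigma> 12 = a" "sv \<sigma> 16 = tail G a" "sv \<sigma> 17 = head G a"
    using st by (simp_all add: stage_ok_def a_def)
  show 1: "nmem \<sigma> (2 * k + 8 + i) x = digit n i x"
    using st i x by (simp add: stage_ok_def digits_ok_def)
  show 2: "nmem \<sigma> (i + 3) (sv \<sigma> 12) = of_bool (a \<in> colour_class I (Suc i))"
    using st i a sv by (simp add: stage_ok_def input_ok_def)
  have mul: "nmem \<sigma> (k + 8 + i) v = v * n ^ i" if "v < n" for v
    using st i that by (simp add: stage_ok_def powers_ok_def)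
  show "candidate k I a val (Suc i) x =
      (if digit n i x = sv \<sigma> 16 \<and> a \<in> colour_class I (Suc i) \<and>
        (nmem \<sigma> (k + 6) (sv \<sigma> 13 + nmem \<sigma> (k + 5) y), rmem \<sigma> 2 (sv \<sigma> 13 + nmem \<sigma> (k + 5) y)) <
        (nmem \<sigma> (k + 6) (sv \<sigma> 13 + nmem \<sigma> (k + 5) x), rmem \<sigma> 2 (sv \<sigma> 13 + nmem \<sigma> (k + 5) x))
       then nmem \<sigma> (k + 5) y else nmem \<sigma> (k + 5) x)"
  proof (cases "digit n i x = sv \<sigma> 16")
    case False
    then show ?thesis using P x sv by (simp add: candidate_def)
  next
    case True
    \<comment> \<open>Digit \<open>i\<close> of \<open>x\<close> is the tail, so the two table
      entries are the products in \<open>move\<close>.\<close>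
    have y: "y = move n i x (head G a)"
      using True mul head_less[OF a] tail_less[OF a] by (simp add: y_def move_def sv)
    have y_less: "y < n ^ k" unfolding y using x i head_less[OF a] by (rule move_less)
    have "digit n i y = head G a" unfolding y using digit_move[OF x i head_less[OF a] i] by simp
    \<comment> \<open>In \<open>y\<close>, walker \<open>i\<close> has left the tail, so this round
      does not change the entry of \<open>y\<close>, and it is immaterial whether \<open>y\<close>
      was already processed.\<close>
    moreover have "head G a \<noteq> tail G a" using height_arc[OF a] by auto
    ultimately have "candidate k I a val (Suc i) y = candidate k I a val i y"
      by (simp add: candidate_def)
    with P y_less have Py: "nmem \<sigma> (k + 5) y = candidate k I a val i y" by auto
    have Px: "nmem \<sigma> (k + 5) x = candidate k I a val i x" using P x by auto
    have less: "candidate k I a val i x < n ^ k" "candidate k I a val i y < n ^ k"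
      using candidate_less[OF _ a] x y_less i by auto
    show ?thesis
      unfolding Py Px stage_ok_layer[OF st less(1)] stage_ok_layer[OF st less(2)] val_def[symmetric]
      using True by (simp add: candidate_def y sv Let_def)
  qed
qed

lemma tri_improve_colour:
  assumes "i < k"
  shows "tri input_size (\<lambda>I \<sigma>. candidates_ok k i I \<sigma> \<and> stage_ok k I \<sigma>) (improve_colour k i)
    (candidates_ok k (Suc i))"
  unfolding improve_colour_def
proof (rule tri_For[where R = "stage_ok k" and N = "\<lambda>I. nv I ^ k" and q = "[:0, 1:] ^ k"
      and Inv = "\<lambda>I \<sigma>. \<forall>z<nv I ^ k. nmem \<sigma> (k + 5) z = candidate k I (sorted_arcs I ! sv \<sigma> 10)
        (layer k I (sv \<sigma> 10)) (if z < sv \<sigma> 11 then Suc i else i) z"], goal_cases)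
  case 1
  show ?case
  proof (rule tri_exec, goal_cases)
    case (2 I \<sigma>)
    then have *: "stage_ok k I \<sigma>" "sv \<sigma> 11 < nv I ^ k"
      "\<forall>z<nv I ^ k. nmem \<sigma> (k + 5) z = candidate k I (sorted_arcs I ! sv \<sigma> 10)
        (layer k I (sv \<sigma> 10)) (if z < sv \<sigma> 11 then Suc i else i) z" by auto
    note step = improve_step[OF *(1) assms *(2,3)]
    define \<tau> where "\<tau> = exec (improve k i) \<sigma>"
    have new: "nmem \<tau> (k + 5) z = (if z = sv \<sigma> 11 then candidate k I (sorted_arcs I ! sv \<sigma> 10)
        (layer k I (sv \<sigma> 10)) (Suc i) z else nmem \<sigma> (k + 5) z)" for z
      unfolding \<tau>_def by (simp add: improve_def step)
    have "sv \<tau> 10 = sv \<sigma> 10" "sv \<tau> 11 = sv \<sigma> 11"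
      unfolding \<tau>_def by (simp_all add: improve_def)
    then show ?case
      unfolding \<tau>_def[symmetric] using *(3) by (auto simp: new less_Suc_eq)
  qed (simp add: improve_def)
next
  case (5 I \<sigma>)
  then show ?case by (simp add: stage_ok_states)
next
  case (6 I \<sigma>)
  show ?case by (rule states_le)
qed (use assms in \<open>auto simp: candidates_ok_def improve_def\<close>)

definition load_arc :: "nat \<Rightarrow> com" where
  "load_arc k = Seq (NStore 0 (Num 12) (NAt (k + 4) (V 10)))
     (Seq (NStore 0 (Num 16) (NAt 1 (V 12))) (NStore 0 (Num 17) (NAt 2 (V 12))))"

definition init_candidates :: "nat \<Rightarrow> com" where
  "init_candidates k = For 11 (V 7) (NStore (k + 5) (V 11) (V 11))"

definition extend_layer :: "nat \<Rightarrow> com" where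
  "extend_layer k = Seq (NStore 0 (Num 15) (NAt (k + 5) (V 11)))
     (Cond (lex_less (NAt (k + 6) (NAdd (V 13) (V 15))) (RAdd (RAt 2 (NAdd (V 13) (V 15))) (RAt 1 (V 12)))
         (NAt (k + 6) (NAdd (V 13) (V 11))) (RAt 2 (NAdd (V 13) (V 11))))
       (Seq (NStore (k + 7) (NAdd (V 14) (V 11)) (V 15))
         (Seq (NStore (k + 6) (NAdd (V 14) (V 11)) (NAt (k + 6) (NAdd (V 13) (V 15))))
           (RStore 2 (NAdd (V 14) (V 11)) (RAdd (RAt 2 (NAdd (V 13) (V 15))) (RAt 1 (V 12))))))
       (Seq (NStore (k + 7) (NAdd (V 14) (V 11)) (V 11))
         (Seq (NStore (k + 6) (NAdd (V 14) (V 11)) (NAt (k + 6) (NAdd (V 13) (V 11))))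
           (RStore 2 (NAdd (V 14) (V 11)) (RAt 2 (NAdd (V 13) (V 11)))))))"

definition next_bases :: com where
  "next_bases = Seq (NStore 0 (Num 13) (V 14)) (NStore 0 (Num 14) (NAdd (V 14) (V 7)))"

definition build_layers :: "nat \<Rightarrow> com" where
  "build_layers k = For 10 (V 1)
     (Seq (load_arc k) (Seq (init_candidates k) (Seq (unroll (improve_colour k) k)
       (Seq (For 11 (V 7) (extend_layer k)) next_bases))))"

lemma tri_load_arc:
  "tri input_size (\<lambda>I \<sigma>. bases_ok k (sv \<sigma> 10) I \<sigma> \<and> setup_ok k I \<sigma> \<and> sv \<sigma> 10 < na I)
    (load_arc k) (stage_ok k)"
  unfolding load_arc_def
proof (rule tri_exec, goal_cases)
  case (2 I \<sigma>)
  then interpret acyclic_instance k I by (simp add: input_ok_def)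
  show ?case
    using 2 sorted_arcs_less[of "sv \<sigma> 10"]
    by (auto simp: stage_ok_def order_ok_def input_ok_tail input_ok_head)
qed simp

lemma tri_init_candidates:
  "tri input_size (stage_ok k) (init_candidates k) (\<lambda>I \<sigma>. candidates_ok k 0 I \<sigma> \<and> stage_ok k I \<sigma>)"
  unfolding init_candidates_def
proof (rule tri_For[where R = "stage_ok k" and N = "\<lambda>I. nv I ^ k" and q = "[:0, 1:] ^ k"
      and Inv = "\<lambda>I \<sigma>. \<forall>x<sv \<sigma> 11. nmem \<sigma> (k + 5) x = x"], goal_cases)
  case 1
  show ?case by (rule tri_exec) (auto simp: less_Suc_eq)
next
  case (6 I \<sigma>)
  show ?case by (rule states_le)
qed (auto simp: stage_ok_states candidates_ok_def candidate_def)

lemma tri_improve_all: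
  "tri input_size (\<lambda>I \<sigma>. candidates_ok k 0 I \<sigma> \<and> stage_ok k I \<sigma>) (unroll (improve_colour k) k)
    (\<lambda>I \<sigma>. candidates_ok k k I \<sigma> \<and> stage_ok k I \<sigma>)"
proof (rule tri_unroll[where Inv = "candidates_ok k" and R = "stage_ok k"])
  fix i assume "i < k"
  then show "tri input_size (\<lambda>I \<sigma>. candidates_ok k i I \<sigma> \<and> stage_ok k I \<sigma>) (improve_colour k i)
      (candidates_ok k (Suc i))"
    by (rule tri_improve_colour)
qed (simp_all add: improve_colour_def improve_def)

text \<open>The contribution of one state to \<open>layers_ok\<close> for \<open>Suc g\<close>, at
  the offset in cell 14, while the new block is still incomplete.\<close>

definition extended :: "nat \<Rightarrow> nat \<Rightarrow> input \<Rightarrow> state \<Rightarrow> nat \<Rightarrow> bool" where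
  "extended k g I \<sigma> x \<longleftrightarrow>
     nmem \<sigma> (k + 6) (sv \<sigma> 14 + x) = fst (layer k I (Suc g) x) \<and>
     rmem \<sigma> 2 (sv \<sigma> 14 + x) = snd (layer k I (Suc g) x) \<and>
     nmem \<sigma> (k + 7) (sv \<sigma> 14 + x) = successor k I (sorted_arcs I ! g) (layer k I g) x"

lemma extend_step:
  fixes k I \<sigma>
  defines "\<tau> \<equiv> exec (extend_layer k) \<sigma>" and "x \<equiv> sv \<sigma> 11"
  assumes st: "stage_ok k I \<sigma>" and c: "candidates_ok k k I \<sigma>" and x: "x < nv I ^ k"
    and E: "\<forall>z<x. extended k (sv \<sigma> 10) I \<sigma> z"
  shows "\<forall>z<Suc x. extended k (sv \<sigma> 10) I \<tau> z"
proof -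
  interpret acyclic_instance k I using st by (simp add: stage_ok_def input_ok_def)
  let ?g = "sv \<sigma> 10"
  let ?a = "sorted_arcs I ! ?g"
  let ?y = "candidate k I ?a (layer k I ?g) k x"
  have a: "?a < m" using st sorted_arcs_less by (simp add: stage_ok_def)
  have y: "?y < n ^ k" "nmem \<sigma> (k + 5) x = ?y"
    using candidate_less[OF x a] c x by (simp_all add: candidates_ok_def)
  have cost: "rmem \<sigma> (Suc 0) (sv \<sigma> 12) = pos_cost I ?a"
    using st a by (simp add: stage_ok_def costs_ok_def)
  note L = stage_ok_layer[OF st x] stage_ok_layer[OF st y(1)]
  have Lx: "nmem \<sigma> (k + 6) (sv \<sigma> 13 + x) = fst (layer k I ?g x)"
    "rmem \<sigma> 2 (sv \<sigma> 13 + x) = snd (layer k I ?g x)"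
    and Ly: "nmem \<sigma> (k + 6) (sv \<sigma> 13 + ?y) = fst (layer k I ?g ?y)"
    "rmem \<sigma> 2 (sv \<sigma> 13 + ?y) = snd (layer k I ?g ?y)"
    using L by (metis fst_conv snd_conv)+
  have add: "add_cost (pos_cost I ?a) (layer k I ?g ?y) =
      (fst (layer k I ?g ?y), snd (layer k I ?g ?y) + pos_cost I ?a)"
    by (simp add: add_cost_def)
  \<comment> \<open>The program branches on the comparison, \<open>layer\<close> on
    \<open>y = x\<close>. The two tests agree because a strictly better value excludes
    equality.\<close>
  have "0 \<le> pos_cost I ?a" by (simp add: pos_cost_def)
  then have ne: "?y \<noteq> x" if "add_cost (pos_cost I ?a) (layer k I ?g ?y) < layer k I ?g x"
    using that by (auto simp: add_cost_def less_prod_def)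
  have sv: "sv \<tau> 14 = sv \<sigma> 14" by (simp add: \<tau>_def extend_layer_def)
  have old: "extended k ?g I \<tau> z" if "z \<noteq> x" "extended k ?g I \<sigma> z" for z
    using that unfolding extended_def sv
    by (simp add: \<tau>_def extend_layer_def x_def[symmetric])
  have succ: "successor k I ?a (layer k I ?g) x =
      (if add_cost (pos_cost I ?a) (layer k I ?g ?y) < layer k I ?g x then ?y else x)"
    by (simp add: successor_def Let_def)
  have layer: "layer k I (Suc ?g) x = (if add_cost (pos_cost I ?a) (layer k I ?g ?y) < layer k I ?g x
      then add_cost (pos_cost I ?a) (layer k I ?g ?y) else layer k I ?g x)"
    using ne by (simp add: Let_def succ)
  have "extended k ?g I \<tau> x"
    unfolding extended_def sv layer succ add
    by (simp add: \<tau>_def extend_layer_def x_def[symmetric] y(2) Lx Ly cost)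
  with old E show ?thesis by (auto simp: less_Suc_eq)
qed

lemma extended_nstore [simp]:
  "a = 0 \<Longrightarrow> j \<noteq> 14 \<Longrightarrow> extended k g I (nstore a j v \<sigma>) x \<longleftrightarrow> extended k g I \<sigma> x"
  by (simp add: extended_def)

lemma tri_extend_all:
  "tri input_size (\<lambda>I \<sigma>. candidates_ok k k I \<sigma> \<and> stage_ok k I \<sigma>) (For 11 (V 7) (extend_layer k))
    (\<lambda>I \<sigma>. stage_ok k I \<sigma> \<and> (\<forall>x<nv I ^ k. extended k (sv \<sigma> 10) I \<sigma> x))"
proof (rule tri_For[where R = "\<lambda>I \<sigma>. candidates_ok k k I \<sigma> \<and> stage_ok k I \<sigma>"
      and N = "\<lambda>I. nv I ^ k" and q = "[:0, 1:] ^ k"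
      and Inv = "\<lambda>I \<sigma>. \<forall>x<sv \<sigma> 11. extended k (sv \<sigma> 10) I \<sigma> x"], goal_cases)
  case 1
  show ?case
  proof (rule tri_exec, goal_cases)
    case (2 I \<sigma>)
    have "sv (exec (extend_layer k) \<sigma>) 10 = sv \<sigma> 10" "sv (exec (extend_layer k) \<sigma>) 11 = sv \<sigma> 11"
      by (simp_all add: extend_layer_def)
    with extend_step[of k I \<sigma>] 2 show ?case by simp
  qed (simp add: extend_layer_def)
next
  case (2 I)
  show ?case using stage_ok_store_above by (simp add: extend_layer_def)
next
  case (6 I \<sigma>)
  show ?case by (rule states_le)
qed (auto simp: stage_ok_states extend_layer_def)

lemma layers_ok_Suc:
  assumes "bases_ok k g I \<sigma>" "\<forall>x<nv I ^ k. extended k g I \<sigma> x"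
  shows "layers_ok k (Suc g) I \<sigma>"
  using assms
  by (auto simp: bases_ok_def layers_ok_def extended_def le_Suc_eq less_Suc_eq simp del: layer.simps)

lemma tri_next_bases:
  "tri input_size (\<lambda>I \<sigma>. stage_ok k I \<sigma> \<and> (\<forall>x<nv I ^ k. extended k (sv \<sigma> 10) I \<sigma> x)) next_bases
    (\<lambda>I \<sigma>. bases_ok k (Suc (sv \<sigma> 10)) I \<sigma>)"
  unfolding next_bases_def
proof (rule tri_exec, goal_cases)
  case (2 I \<sigma>)
  then have "layers_ok k (Suc (sv \<sigma> 10)) I \<sigma>" "sv \<sigma> 14 = Suc (sv \<sigma> 10) * nv I ^ k"
    by (auto intro: layers_ok_Suc simp: stage_ok_def bases_ok_def)
  with 2 stage_ok_states show ?case by (simp add: bases_ok_def)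
qed simp

lemma tri_build_layers:
  "tri input_size (\<lambda>I \<sigma>. setup_ok k I \<sigma> \<and> bases_ok k 0 I \<sigma>) (build_layers k)
    (\<lambda>I \<sigma>. setup_ok k I \<sigma> \<and> bases_ok k (na I) I \<sigma>)"
  unfolding build_layers_def
proof (rule tri_For[where R = "setup_ok k" and N = na and q = "[:0, 1:]"
      and Inv = "\<lambda>I \<sigma>. bases_ok k (sv \<sigma> 10) I \<sigma>"], goal_cases)
  case 1
  have "tri input_size (\<lambda>I \<sigma>. bases_ok k (sv \<sigma> 10) I \<sigma> \<and> setup_ok k I \<sigma> \<and> sv \<sigma> 10 < na I)
    (Seq (load_arc k) (Seq (init_candidates k) (Seq (unroll (improve_colour k) k)
       (Seq (For 11 (V 7) (extend_layer k)) next_bases)))) (\<lambda>I \<sigma>. bases_ok k (Suc (sv \<sigma> 10)) I \<sigma>)"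
    by (rule tri_Seq[OF tri_load_arc tri_Seq[OF tri_init_candidates tri_Seq[OF tri_improve_all
          tri_Seq[OF tri_extend_all tri_next_bases]]]])
  then show ?case by (rule tri_conseq) simp_all
next
  case (2 I)
  show ?case
    by (auto simp: load_arc_def init_candidates_def improve_colour_def improve_def extend_layer_def
      next_bases_def intro!: stable_unroll)
next
  case (3 v)
  show ?case
    by (auto simp: load_arc_def init_candidates_def improve_colour_def improve_def extend_layer_def
      next_bases_def intro!: stable_unroll)
qed (auto intro: input_ok_scalars)

section \<open>Reading off a solution\<close>

text \<open>\<open>input_ok\<close> has to be given up, as the output overwrites the tails in array
  1. What remains is enough for tracing back and reporting.\<close>

definition final_ok :: "nat \<Rightarrow> input \<Rightarrow> state \<Rightarrow> bool" where
  "final_ok k I \<sigma> \<longleftrightarrow> acyclic_instance k I \<and> sv \<sigma> 1 = na I \<and> order_ok k I \<sigma> \<and> powers_ok k k I \<sigma> \<and>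
     layers_ok k (na I) I \<sigma> \<and> (\<forall>a<na I. rmem \<sigma> 0 a = cost I a) \<and> sv \<sigma> 14 = Suc (na I) * nv I ^ k"

lemma final_ok_nstore [simp]:
  "a = 1 \<or> a = 0 \<and> (j = 5 \<or> 10 \<le> j \<and> j < 14) \<Longrightarrow> final_ok k I (nstore a j x \<sigma>) \<longleftrightarrow> final_ok k I \<sigma>"
  by (auto simp: final_ok_def)

definition marked :: "input \<Rightarrow> nat set \<Rightarrow> state \<Rightarrow> bool" where
  "marked I S \<sigma> \<longleftrightarrow> (\<forall>a<na I. nmem \<sigma> 1 a = of_bool (a \<in> S))"

lemma marked_nstore [simp]: "a = 0 \<Longrightarrow> marked I S (nstore a j x \<sigma>) \<longleftrightarrow> marked I S \<sigma>"
  by (simp add: marked_def)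

lemma marked_insert: "marked I S \<sigma> \<Longrightarrow> marked I (insert a S) (nstore (Suc 0) a (Suc 0) \<sigma>)"
  by (simp add: marked_def)

abbreviation negative_arcs :: "input \<Rightarrow> nat set" where
  "negative_arcs I \<equiv> {a. a < na I \<and> cost I a < 0}"

definition mark_negative :: com where
  "mark_negative = Seq (For 5 (V 1) (Cond (RLess (RAt 0 (V 5)) RZero)
     (NStore 1 (V 5) (Num 1)) (NStore 1 (V 5) (Num 0)))) (NStore 0 (Num 11) (V 8))"

text \<open>After \<open>g\<close> steps, the marked arcs and the solution still to be traced make
  up the answer. Stating the union allows arcs that are both negative and chosen.\<close>

definition trace_state :: "nat \<Rightarrow> input \<Rightarrow> nat \<Rightarrow> state \<Rightarrow> bool" where
  "trace_state k I g \<sigma> \<longleftrightarrow> g \<le> na I \<and> sv \<sigma> 11 < nv I ^ k \<and> sv \<sigma> 13 = (na I - g) * nv I ^ k \<and>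
     (\<exists>S. marked I S \<sigma> \<and> S \<union> solution k I (na I - g) (sv \<sigma> 11) =
       solution k I (na I) (index_of (nv I) k (\<lambda>_. source I)) \<union> negative_arcs I)"

lemma trace_state_nstore [simp]:
  "a = 0 \<Longrightarrow> j \<noteq> 11 \<Longrightarrow> j \<noteq> 13 \<Longrightarrow> trace_state k I g (nstore a j x \<sigma>) \<longleftrightarrow> trace_state k I g \<sigma>"
  by (simp add: trace_state_def)

lemma tri_mark_negative:
  "tri input_size (\<lambda>I \<sigma>. setup_ok k I \<sigma> \<and> bases_ok k (na I) I \<sigma>) mark_negative
    (\<lambda>I \<sigma>. final_ok k I \<sigma> \<and> trace_state k I 0 \<sigma>)"
  unfolding mark_negative_def
proof (rule tri_Seq[where B = "\<lambda>I \<sigma>. (final_ok k I \<sigma> \<and> sv \<sigma> 13 = na I * nv I ^ k) \<and>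
    marked I (negative_arcs I) \<sigma>"], goal_cases)
  case 1
  show ?case
  proof (rule tri_For[where R = "\<lambda>I \<sigma>. final_ok k I \<sigma> \<and> sv \<sigma> 13 = na I * nv I ^ k"
      and N = na and q = "[:0, 1:]"
      and Inv = "\<lambda>I \<sigma>. \<forall>a<sv \<sigma> 5. nmem \<sigma> 1 a = of_bool (cost I a < 0)"], goal_cases)
    case 1
    show ?case by (rule tri_exec) (auto simp: final_ok_def less_Suc_eq)
  next
    case (8 I \<sigma>)
    then show ?case by (simp add: final_ok_def bases_ok_def input_ok_def)
  qed (auto simp: marked_def, auto simp: final_ok_def)
next
  case 2
  show ?case
  proof (rule tri_exec, goal_cases)
    case (2 I \<sigma>)
    then interpret acyclic_instance k I by (simp add: final_ok_def)
    have "sv \<sigma> 8 = start" using 2 by (simp add: final_ok_def powers_ok_def)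
    with 2 start_less show ?case by (auto simp: trace_state_def)
  qed simp
qed

text \<open>This also runs on infeasible instances: every state has a successor, and the flag alone
  decides the report there.\<close>

definition trace_back :: "nat \<Rightarrow> com" where
  "trace_back k = For 10 (V 1)
     (Seq (Cond (eq_test (NAt (k + 7) (NAdd (V 13) (V 11))) (V 11)) Skip
       (Seq (NStore 1 (NAt (k + 4) (NSub (V 1) (NAdd (V 10) (Num 1)))) (Num 1))
         (NStore 0 (Num 11) (NAt (k + 7) (NAdd (V 13) (V 11))))))
       (NStore 0 (Num 13) (NSub (V 13) (V 7))))"

lemma trace_step:
  assumes f: "final_ok k I \<sigma>" and t: "trace_state k I (sv \<sigma> 10) \<sigma>" and "sv \<sigma> 10 < na I"
  defines "g \<equiv> na I - Suc (sv \<sigma> 10)" and "x \<equiv> sv \<sigma> 11"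
  defines "y \<equiv> nmem \<sigma> (k + 7) (sv \<sigma> 13 + x)"
  shows "trace_state k I (Suc (sv \<sigma> 10))
    (nstore 0 13 (sv \<sigma> 13 - nv I ^ k) (if y = x then \<sigma> else
      nstore 0 11 y (nstore (Suc 0) (sorted_arcs I ! g) (Suc 0) \<sigma>)))"
proof -
  interpret acyclic_instance k I using f by (simp add: final_ok_def)
  \<comment> \<open>The current state belongs to layer \<open>Suc g\<close>, whose last decision
    concerned the arc with index \<open>g\<close>.\<close>
  have g: "na I - sv \<sigma> 10 = Suc g" "g < m" using assms(3) by (simp_all add: g_def)
  have x: "x < n ^ k" and base: "sv \<sigma> 13 = Suc g * n ^ k"
    using t g by (simp_all add: trace_state_def x_def)
  have y: "y = successor k I (sorted_arcs I ! g) (layer k I g) x"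
    using f g(2) x unfolding y_def base by (simp add: final_ok_def layers_ok_def)
  have y_less: "y < n ^ k"
    unfolding y using x sorted_arcs_less[OF g(2)] by (rule successor_less)
  obtain S where S: "marked I S \<sigma>" "S \<union> solution k I (Suc g) x = answer"
    using t g(1) by (auto simp: trace_state_def x_def)
  show ?thesis
  proof (cases "y = x")
    case True
    then show ?thesis
      using S x base assms(3) y by (auto simp: trace_state_def g_def[symmetric] x_def[symmetric] Let_def)
  next
    case False
    then have "insert (sorted_arcs I ! g) S \<union> solution k I g y = answer"
      using S(2) y by (simp add: Let_def)
    with False S(1) y_less base assms(3) show ?thesis
      by (auto simp: trace_state_def g_def[symmetric] intro!: exI[of _ "insert (sorted_arcs I ! g) S"] marked_insert)
  qed
qed

lemma tri_trace_back:
  "tri input_size (\<lambda>I \<sigma>. final_ok k I \<sigma> \<and> trace_state k I 0 \<sigma>) (trace_back k)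
    (\<lambda>I \<sigma>. final_ok k I \<sigma> \<and> trace_state k I (na I) \<sigma>)"
  unfolding trace_back_def
proof (rule tri_For[where R = "final_ok k" and N = na and q = "[:0, 1:]"
      and Inv = "\<lambda>I \<sigma>. trace_state k I (sv \<sigma> 10) \<sigma>"], goal_cases)
  case 1
  show ?case
  proof (rule tri_exec, goal_cases)
    case (2 I \<sigma>)
    then interpret acyclic_instance k I by (simp add: final_ok_def)
    have *: "sv \<sigma> (Suc 0) = m" "sv \<sigma> 7 = n ^ k"
      "nmem \<sigma> (k + 4) (m - Suc (sv \<sigma> 10)) = sorted_arcs I ! (m - Suc (sv \<sigma> 10))"
      using 2 by (simp_all add: final_ok_def powers_ok_def order_ok_def)
    show ?case using trace_step[of k I \<sigma>] 2 by (auto simp: * split: if_splits)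
  qed simp
qed (auto, auto simp: final_ok_def)

text \<open>Tracing back has lowered cell 13 to 0, so the offset of the last layer is recovered from
  cell 14, which is one block beyond it.\<close>

definition report :: "nat \<Rightarrow> com" where
  "report k = Cond (NLess (Num 0) (NAt (k + 6) (NAdd (NSub (V 14) (V 7)) (V 8))))
     (NStore 0 (Num 0) (Num 0)) (NStore 0 (Num 0) (Num 1))"

lemma tri_report:
  "tri input_size (\<lambda>I \<sigma>. final_ok k I \<sigma> \<and> trace_state k I (na I) \<sigma>) (report k) (correct_output k)"
  unfolding report_def
proof (rule tri_exec, goal_cases)
  case (2 I \<sigma>)
  then interpret acyclic_instance k I by (simp add: final_ok_def)
  have *: "sv \<sigma> 14 - sv \<sigma> 7 + sv \<sigma> 8 = m * n ^ k + start"
    using 2 by (simp add: final_ok_def powers_ok_def)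
  have flag: "nmem \<sigma> (k + 6) (sv \<sigma> 14 - sv \<sigma> 7 + sv \<sigma> 8) = fst (layer k I m start)"
    unfolding * using 2 start_less by (simp add: final_ok_def layers_ok_def)
  have "marked I answer \<sigma>"
    using 2 by (auto simp: trace_state_def)
  then have "{a \<in> arcs G. nmem \<sigma> (Suc 0) a = Suc 0} = answer"
    using answer_subset in_arcs by (auto simp: marked_def split: if_splits)
  then show ?case
    using flag feasible_iff answer_optimal by (auto simp: correct_output_def)
qed simp

section \<open>The complete program\<close>

definition solver :: "nat \<Rightarrow> com" where
  "solver k = Seq (relax_heights k) (Seq (sort_arcs k) (Seq set_costs (Seq (set_powers k)
     (Seq (set_digits k) (Seq (init_layer k) (Seq (build_layers k)
       (Seq mark_negative (Seq (trace_back k) (report k)))))))))"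

lemma tri_solver:
  "tri input_size (\<lambda>I \<sigma>. input_ok k I \<sigma> \<and> (\<forall>v. nmem \<sigma> (k + 3) v = 0)) (solver k) (correct_output k)"
  unfolding solver_def
  by (rule tri_Seq[OF tri_relax_heights tri_Seq[OF tri_sort_arcs tri_Seq[OF tri_set_costs
    tri_Seq[OF tri_set_powers tri_Seq[OF tri_set_digits tri_Seq[OF tri_init_layer
    tri_Seq[OF tri_build_layers tri_Seq[OF tri_mark_negative tri_Seq[OF tri_trace_back
    tri_report]]]]]]]]])

lemma input_ok_encode:
  assumes "acyclic_instance k I"
  shows "input_ok k I (encode k I)"
  using assms by (simp add: input_ok_def encode_def Let_def)

theorem theorem3p3:
  fixes k :: nat
  assumes "k \<ge> 1"
  shows "poly_time_solvable
           {I. numbered I \<and> valid_instance k I \<and> acyclic_digraph (graph I)}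
           (encode k) input_size (correct_output k)"
proof -
  \<comment> \<open>\<open>solver k\<close> depends on \<open>k\<close> alone, and
    \<open>tri\<close> fixes the polynomial before the instance, as
    \<open>poly_time_solvable\<close> demands.\<close>
  obtain p :: "nat poly" where p: "\<forall>I \<sigma>. input_ok k I \<sigma> \<and> (\<forall>v. nmem \<sigma> (k + 3) v = 0) \<longrightarrow>
      (\<exists>t \<tau>. run (solver k) \<sigma> t \<tau> \<and> t \<le> poly p (input_size I) \<and> correct_output k I \<tau>)"
    using tri_solver[of k] unfolding tri_def by blast
  have "\<exists>t \<tau>. run (solver k) (encode k I) t \<tau> \<and> t \<le> poly p (input_size I) \<and> correct_output k I \<tau>"
    if "numbered I \<and> valid_instance k I \<and> acyclic_digraph (graph I)" for I
  proof -
    have "acyclic_instance k I" using that by (simp add: acyclic_instance_def)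
    then have "input_ok k I (encode k I)" by (rule input_ok_encode)
    \<comment> \<open>The colour classes end with array \<open>k + 2\<close>, so the array of
      heights starts out zero, as the relaxation requires.\<close>
    moreover have "\<forall>v. nmem (encode k I) (k + 3) v = 0" by (simp add: encode_def Let_def)
    ultimately show ?thesis using p by blast
  qed
  then show ?thesis unfolding poly_time_solvable_def by blast
qed

end
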